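(* Let $k\in\mathbb N$, $0<p<1$, $\alpha\ge0$, $\beta\ge0$ and $f\in L_p^{\alpha,\beta}$. Then there exists a positive constant $\vartheta\le1$ depending only on $k,p,\alpha,\beta$ such that, for any $n\in\mathbb N$, $$\omega_{k,0}^{\varphi}(f,\vartheta n^{-1})_{\alpha,\beta,p}^p\le c\,n^{-kp}\sum_{m=1}^n m^{kp-1}E_m(f)_{\alpha,\beta,p}^p,$$ where $c$ is a constant depending only on $k,p,\alpha,\beta$.
   Context: Jacobi weight: $w_{\alpha,\beta}(x)=(1-x)^\alpha(1+x)^\beta$. $\varphi(x)=\sqrt{1-x^2}$. $\|\cdot\|_p$ is the usual $L_p$ quasinorm on $[-1,1]$. $L_p^{\alpha,\beta}=\{f:\|w_{\alpha,\beta}f\|_p<\infty\}$ (functions on $[-1,1]$, identified if equal a.e.). $\mathbb P_n$ is the set of algebraic polynomials of degree not more than $n-1$, and $E_n(f)_{\alpha,\beta,p}=\inf_{p_n\in\mathbb P_n}\|w_{\alpha,\beta}(f-p_n)\|_p$ (also written $E_n(f)_{w_{\alpha,\beta},p}$). Symmetric difference: $\Delta_h^k(f,x)=\sum_{i=0}^k\binom ki(-1)^{k-i}f(x-\frac{kh}2+ih)$ if $[x-\frac{kh}2,x+\frac{kh}2]\subseteq[-1,1]$, and $\Delta_h^k(f,x)=0$ otherwise. $\mathcal W_\delta^{\xi,\zeta}(x)=(1-x-\delta\varphi(x)/2)^\xi(1+x-\delta\varphi(x)/2)^\zeta$. Modulus: for $t>0$, $$\omega_{k,0}^{\varphi}(f,t)_{\alpha,\beta,p}=\sup_{0\le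 h\le t}\big\|\mathcal W_{kh}^{\alpha,\beta}(\cdot)\,\Delta_{h\varphi(\cdot)}^k(f,\cdot)\big\|_p,$$ where the expression under the norm is understood to be $0$ at points $x$ where $\Delta^k_{h\varphi(x)}(f,x)$ is set to $0$ because $[x-\frac{kh\varphi(x)}{2},x+\frac{kh\varphi(x)}{2}]\not\subseteq[-1,1]$. *)

theory Defs
  imports "HOL-Analysis.Analysis" "HOL-Computational_Algebra.Polynomial"
begin

definition ennreal_powr :: "ennreal \<Rightarrow> real \<Rightarrow> ennreal" where
  "ennreal_powr x r = (if x = \<infinity> then \<infinity> else ennreal (enn2real x powr r))"
  \<comment> \<open>used for exponents \<open>r > 0\<close> only\<close>

text \<open>The quasinorm takes values in \<^typ>\<open>ennreal\<close>, so that it is \<open>\<infinity>\<close>, not an arbitrary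
  default, when the integral diverges.\<close>

definition Lp_norm :: "real \<Rightarrow> (real \<Rightarrow> real) \<Rightarrow> ennreal" where
  "Lp_norm p g =
     ennreal_powr (\<integral>\<^sup>+x. ennreal (\<bar>g x\<bar> powr p) \<partial>lebesgue_on {-1..1}) (1 / p)"

text \<open>In HOL \<open>0 powr 0 = 0\<close>. For a zero exponent the two weights below may therefore differ from
  the convention \<open>0\<^sup>0 = 1\<close> where a base vanishes. For each fixed value of the parameter this
  happens at finitely many points of \<open>[-1, 1]\<close>, so it changes no quasinorm.\<close>

definition jacobi_weight :: "real \<Rightarrow> real \<Rightarrow> real \<Rightarrow> real" where
  "jacobi_weight \<alpha> \<beta> x = (1 - x) powr \<alpha> * (1 + x) powr \<beta>"

definition phi :: "real \<Rightarrow> real" where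
  "phi x = sqrt (1 - x\<^sup>2)"

definition shifted_weight :: "real \<Rightarrow> real \<Rightarrow> real \<Rightarrow> real \<Rightarrow> real" where
  "shifted_weight \<xi> \<zeta> \<delta> x =
     (1 - x - \<delta> * phi x / 2) powr \<xi> * (1 + x - \<delta> * phi x / 2) powr \<zeta>"

text \<open>Elements of the space are Lebesgue measurable representatives; their values outside
  \<open>[-1, 1]\<close> play no role.\<close>

definition weighted_Lp :: "real \<Rightarrow> real \<Rightarrow> real \<Rightarrow> (real \<Rightarrow> real) set" where
  "weighted_Lp \<alpha> \<beta> p =
     {f \<in> borel_measurable (lebesgue_on {-1..1}). Lp_norm p (\<lambda>x. jacobi_weight \<alpha> \<beta> x * f x) < \<infinity>}"

text \<open>Degree at most \<open>n - 1\<close>, for \<open>n \<ge> 1\<close>.\<close>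

definition polys_below :: "nat \<Rightarrow> real poly set" where
  "polys_below n = {q. degree q < n}"

definition best_approx :: "nat \<Rightarrow> (real \<Rightarrow> real) \<Rightarrow> real \<Rightarrow> real \<Rightarrow> real \<Rightarrow> ennreal" where
  "best_approx n f \<alpha> \<beta> p =
     (INF q\<in>polys_below n. Lp_norm p (\<lambda>x. jacobi_weight \<alpha> \<beta> x * (f x - poly q x)))"

definition sym_diff :: "nat \<Rightarrow> real \<Rightarrow> (real \<Rightarrow> real) \<Rightarrow> real \<Rightarrow> real" where
  "sym_diff k h f x =
     (if {x - real k * h / 2 .. x + real k * h / 2} \<subseteq> {-1..1}
      then \<Sum>i=0..k. real (k choose i) * (-1) ^ (k - i) * f (x - real k * h / 2 + real i * h)
      else 0)"

text \<open>Where the step leaves \<open>[-1, 1]\<close> the difference is \<open>0\<close> by definition, and hence so is the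
  product under the norm, whatever value the weight has there.\<close>

definition phi_modulus ::
  "nat \<Rightarrow> (real \<Rightarrow> real) \<Rightarrow> real \<Rightarrow> real \<Rightarrow> real \<Rightarrow> real \<Rightarrow> ennreal" where
  "phi_modulus k f t \<alpha> \<beta> p =
     (SUP h\<in>{0..t}. Lp_norm p (\<lambda>x. shifted_weight \<alpha> \<beta> (real k * h) x * sym_diff k (h * phi x) f x))"

end

theory Submission
  imports Defs "HOL-Complex_Analysis.Complex_Analysis"
begin

text \<open>With \<open>x = cos t\<close> and \<open>z = e\<^sup>i\<^sup>t\<close>, a polynomial \<open>P\<close> of degree \<open>d\<close> becomes, up to the factor \<open>z\<^sup>d\<close>, a
  polynomial \<open>G\<close> on the unit circle, and \<open>|w P|\<^sup>p dx\<close> becomes \<open>v dt\<close> up to a constant, where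
  \<open>v(z) = |G(z)|\<^sup>p |z - 1|\<^sup>a |z + 1|\<^sup>b\<close>. Reflecting the roots lying in a disc gives a zero-free
  holomorphic function with modulus \<open>v\<close> on its boundary and at least \<open>v\<close> inside, so that \<open>v\<close> is bounded by its
  Poisson integral for every \<open>p > 0\<close>. This has two consequences: the mean of \<open>v\<close> over circles of
  radius \<open>\<le> 1 + 1/n\<close> is controlled by its mean over the unit circle, and \<open>|P|\<^sup>p\<close> times the weight is
  bounded on a disc of radius \<open>\<phi>(x)/(8n)\<close> around \<open>x\<close> by a mean of \<open>v\<close> over a circle of radius \<open>1/n\<close>.
  Cauchy's inequalities turn the latter into
  \<open>\<parallel>w \<Delta>\<^sup>k P\<parallel>\<^sup>p \<le> C (n h)\<^sup>k\<^sup>p \<parallel>w P\<parallel>\<^sup>p\<close> for \<open>deg P < n\<close>. Together with the boundedness of the weighted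
  difference operator on the space, the theorem follows by telescoping near-best approximants of
  dyadic degrees, using that \<open>\<parallel>\<sqdot>\<parallel>\<^sup>p\<close> is subadditive for \<open>p \<le> 1\<close>.\<close>

section \<open>Poisson majorants of products of root factors\<close>

text \<open>The endpoint factors enter on the same footing as the root factors |z - r|^p. Their
  exponents a = 2 \<alpha> p + 1 and b = 2 \<beta> p + 1 come from 1 - cos t = |z - 1|^2 / 2, 1 +
  cos t = |z + 1|^2 / 2 and the Jacobian |sin t| = |z - 1| |z + 1| / 2, so they are positive even if
  \<alpha> or \<beta> is 0. The obstacle is local: a disc of radius 1/n near z = 1 or z = -1 may
  contain a zero of v although the weight at its centre does not vanish. Reflecting 1 and -1 as well
  bounds their factors below by half their values at the centre. The radius \<phi>(x)/(8n) is chosen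
  so that the map (z + 1/z)/2 pulls such a disc back to distance at most 1/(2n), uniformly up to the
  endpoints; requiring the span k h \<phi>(x) to fit that radius gives \<theta> = 1/(8k).
  Polynomials make sense outside [-1, 1], so their differences are estimated without cut-off and
  with the plain weight at x. The shifted weight is essential only for the remainder f - P, where it
  lies below the Jacobi weight at every node.\<close>

definition circ :: "real \<Rightarrow> complex" where
  "circ x = exp (2 * of_real pi * \<i> * of_real x)"

lemma norm_circ [simp]: "cmod (circ x) = 1"
  by (simp add: circ_def)

lemma circ_nonzero [simp]: "circ x \<noteq> 0"
  by (simp add: circ_def)

lemma continuous_on_circ [continuous_intros]:
  "continuous_on S f \<Longrightarrow> continuous_on S (\<lambda>x. circ (f x))"
  unfolding circ_def by (intro continuous_intros)

lemma circ_eq: "circ x = Complex (cos (2 * pi * x)) (sin (2 * pi * x))"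
proof -
  have "circ x = exp (\<i> * of_real (2 * pi * x))"
    by (simp add: circ_def mult_ac)
  then show ?thesis
    by (simp only: cis_conv_exp[symmetric] cis.code)
qed

lemma cnj_circ_mult [simp]: "cnj (circ x) * circ x = 1" "circ x * cnj (circ x) = 1"
proof -
  show "circ x * cnj (circ x) = 1"
    using complex_norm_square[of "circ x"] by simp
  then show "cnj (circ x) * circ x = 1" by (simp add: mult.commute)
qed

definition pois :: "complex \<Rightarrow> complex \<Rightarrow> real" where
  "pois z w = (1 - (cmod z)\<^sup>2) / (cmod (w - z))\<^sup>2"

lemma pois_nonneg: "cmod z < 1 \<Longrightarrow> pois z w \<ge> 0"
  unfolding pois_def by (simp add: power_le_one)

lemma pois_le_3:
  assumes "cmod z \<le> 1/2"
  shows "pois z (circ x) \<le> 3"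
proof -
  have 1: "cmod (circ x - z) \<ge> 1 - cmod z"
    using norm_triangle_ineq2[of "circ x" z] by simp
  have "1 - (cmod z)\<^sup>2 \<le> 3 * (1 - cmod z)\<^sup>2"
  proof -
    have "3 * (1 - cmod z)\<^sup>2 - (1 - (cmod z)\<^sup>2) = 2 * (1 - cmod z) * (1 - 2 * cmod z)"
      by (simp add: algebra_simps power2_eq_square)
    also have "\<dots> \<ge> 0" using assms by simp
    finally show ?thesis by simp
  qed
  also have "\<dots> \<le> 3 * (cmod (circ x - z))\<^sup>2"
    using 1 assms by (intro mult_left_mono power_mono) auto
  finally have "1 - (cmod z)\<^sup>2 \<le> 3 * (cmod (circ x - z))\<^sup>2" .
  moreover have "cmod (circ x - z) > 0" using 1 assms by linarith
  ultimately show ?thesis unfolding pois_def by (simp add: divide_simps)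
qed

lemma continuous_on_pois [continuous_intros]:
  assumes "cmod z < 1" "continuous_on S f" "\<And>x. x \<in> S \<Longrightarrow> cmod (f x) = 1"
  shows "continuous_on S (\<lambda>x. pois z (f x))"
  unfolding pois_def using assms by (intro continuous_intros) auto

text \<open>Cauchy's formula is applied not to F but to \<open>H\<close>, which agrees with F at z.
  On the unit circle 1 - cnj z * u = |u - z|^2 u / (u - z), and this turns the Cauchy kernel into
  the Poisson kernel.\<close>

lemma poisson_formula:
  assumes cont: "continuous_on (cball 0 1) F" and hol: "F holomorphic_on ball 0 1" and z: "cmod z < 1"
  shows "((\<lambda>x. F (circ x) * of_real (pois z (circ x))) has_integral F z) {0..1}"
proof -
  define H where "H = (\<lambda>u. F u * (1 - of_real ((cmod z)\<^sup>2)) / (1 - cnj z * u))"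
  have nz: "1 - cnj z * u \<noteq> 0" if "cmod u \<le> 1" for u
  proof
    assume "1 - cnj z * u = 0"
    then have "cmod (cnj z * u) = 1" by (metis eq_iff_diff_eq_0 norm_one)
    moreover have "cmod z * cmod u \<le> cmod z * 1" using that by (intro mult_left_mono) auto
    ultimately show False using z by (simp add: norm_mult)
  qed
  have contH: "continuous_on (cball 0 1) H"
    unfolding H_def using nz by (intro continuous_intros cont) auto
  have holH: "H holomorphic_on ball 0 1"
    unfolding H_def using nz by (intro holomorphic_intros hol) auto
  have "((\<lambda>u. H u / (u - z)) has_contour_integral (2 * of_real pi * \<i> * H z)) (circlepath 0 1)"
    by (rule Cauchy_integral_circlepath[OF contH holH]) (use z in auto)
  then have "((\<lambda>x. H (circlepath 0 1 x) / (circlepath 0 1 x - z) *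
      vector_derivative (circlepath 0 1) (at x within {0..1})) has_integral (2 * of_real pi * \<i> * H z)) {0..1}"
    unfolding has_contour_integral_def .
  then have *: "((\<lambda>x. H (circ x) / (circ x - z) * (2 * of_real pi * \<i> * circ x))
      has_integral (2 * of_real pi * \<i> * H z)) {0..1}"
  proof (rule has_integral_eq[rotated])
    fix x :: real assume "x \<in> {0..1}"
    then have "vector_derivative (circlepath 0 1) (at x within {0..1}) = 2 * of_real pi * \<i> * circ x"
      by (simp add: vector_derivative_circlepath01 circ_def)
    moreover have "circlepath 0 1 x = circ x" by (simp add: circlepath circ_def)
    ultimately show "H (circlepath 0 1 x) / (circlepath 0 1 x - z) *
      vector_derivative (circlepath 0 1) (at x within {0..1}) =
      H (circ x) / (circ x - z) * (2 * of_real pi * \<i> * circ x)" by simp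
  qed
  have "((\<lambda>x. H (circ x) / (circ x - z) * circ x) has_integral H z) {0..1}"
    using has_integral_mult_right[OF *, of "inverse (2 * of_real pi * \<i>)"]
    by (simp add: field_simps)
  moreover have "H z = F z"
    unfolding H_def using nz[of z] z complex_norm_square[of z]
    by (simp add: field_simps)
  moreover have "H (circ x) / (circ x - z) * circ x = F (circ x) * of_real (pois z (circ x))" for x
  proof -
    have ne: "circ x - z \<noteq> 0" using z by auto
    have "of_real ((cmod (circ x - z))\<^sup>2) = (circ x - z) * cnj (circ x - z)"
      by (rule complex_norm_square)
    then have "of_real ((cmod (circ x - z))\<^sup>2) * circ x = (circ x - z) * ((cnj (circ x) - cnj z) * circ x)"
      by (simp add: mult.assoc)
    moreover have "(cnj (circ x) - cnj z) * circ x = 1 - cnj z * circ x"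
      by (simp add: left_diff_distrib)
    ultimately have "of_real ((cmod (circ x - z))\<^sup>2) * circ x = (circ x - z) * (1 - cnj z * circ x)"
      by simp
    then have *: "1 - cnj z * circ x = of_real ((cmod (circ x - z))\<^sup>2) * circ x / (circ x - z)"
      using ne by (simp add: field_simps)
    show ?thesis
      unfolding H_def pois_def * using ne by (simp add: field_simps)
  qed
  ultimately show ?thesis by simp
qed

lemma poisson_bound:
  assumes cont: "continuous_on (cball 0 1) F" and hol: "F holomorphic_on ball 0 1" and z: "cmod z < 1"
  shows "cmod (F z) \<le> integral {0..1} (\<lambda>x. cmod (F (circ x)) * pois z (circ x))"
proof -
  have cF: "continuous_on {0..1} (\<lambda>x. F (circ x))"
    by (rule continuous_on_compose2[OF cont]) (auto intro!: continuous_intros)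
  have "cmod (F z) = cmod (integral {0..1} (\<lambda>x. F (circ x) * of_real (pois z (circ x))))"
    using poisson_formula[OF assms] by (simp add: integral_unique)
  also have "\<dots> \<le> integral {0..1} (\<lambda>x. cmod (F (circ x)) * pois z (circ x))"
  proof (rule integral_norm_bound_integral)
    show "(\<lambda>x. F (circ x) * of_real (pois z (circ x))) integrable_on {0..1}"
      using poisson_formula[OF assms] by auto
    show "(\<lambda>x. cmod (F (circ x)) * pois z (circ x)) integrable_on {0..1}"
      using z by (intro integrable_continuous_real continuous_intros cF) auto
  qed (use pois_nonneg[OF z] in \<open>auto simp: norm_mult\<close>)
  finally show ?thesis .
qed

lemma integral_pois:
  assumes "cmod z < 1"
  shows "integral {0..1} (\<lambda>x. pois z (circ x)) = 1"
proof -
  have "((\<lambda>x. complex_of_real (pois z (circ x))) has_integral 1) {0..1}"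
    using poisson_formula[of "\<lambda>_. 1" z] assms by simp
  from has_integral_linear[OF this bounded_linear_Re] show ?thesis
    by (simp add: o_def integral_unique)
qed

text \<open>The modulus of the function, zero-free in the open unit disc, that results from \<open>z - a\<close> by
  reflecting a root \<open>a\<close> in that disc.\<close>

definition refl :: "complex \<Rightarrow> complex \<Rightarrow> real" where
  "refl a z = (if cmod a \<ge> 1 then cmod (z - a) else cmod (1 - cnj a * z))"

lemma refl_circ: "refl a (circ x) = cmod (circ x - a)"
proof (cases "cmod a \<ge> 1")
  case False
  have "cmod (1 - cnj a * circ x) = cmod (cnj (circ x) - cnj a) * cmod (circ x)"
    by (subst norm_mult[symmetric]) (simp add: algebra_simps)
  also have "\<dots> = cmod (cnj (circ x - a))" by simp
  finally show ?thesis using False by (simp only: refl_def complex_mod_cnj) simp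
qed (auto simp: refl_def)

lemma refl_nonneg: "refl a z \<ge> 0" by (simp add: refl_def)

text \<open>For |a| < 1 the quotient of the two moduli is that of a Blaschke factor: the squares
  differ by (1 - |a|^2) (1 - |z|^2). With \<open>refl_circ\<close>, reflection keeps the modulus on
  the circle and can only enlarge it inside.\<close>

lemma refl_ge:
  assumes "cmod z \<le> 1"
  shows "cmod (z - a) \<le> refl a z"
proof (cases "cmod a \<ge> 1")
  case False
  have "(cmod (1 - cnj a * z))\<^sup>2 - (cmod (z - a))\<^sup>2 = (1 - (cmod a)\<^sup>2) * (1 - (cmod z)\<^sup>2)"
    by (simp only: cmod_power2 minus_complex.sel times_complex.sel complex_cnj one_complex.sel cnj.sel) algebra
  also have "\<dots> \<ge> 0" using False assms by (intro mult_nonneg_nonneg) (auto simp: power_le_one)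
  finally have "(cmod (z - a))\<^sup>2 \<le> (cmod (1 - cnj a * z))\<^sup>2" by simp
  then have "cmod (z - a) \<le> cmod (1 - cnj a * z)" by (rule power2_le_imp_le) simp
  then show ?thesis using False by (simp add: refl_def)
qed (auto simp: refl_def)

text \<open>A reflected factor has no zero in the open disc, so on the half disc it stays away from
  0 even where z - a vanishes. This serves the endpoints 1 and -1, whose factors must survive in a
  lower bound.\<close>

lemma refl_ge_half:
  assumes "cmod z \<le> 1/2"
  shows "max 1 (cmod a) / 2 \<le> refl a z"
proof (cases "cmod a \<ge> 1")
  case True
  have "cmod a - cmod z \<le> cmod (z - a)" by (metis norm_minus_commute norm_triangle_ineq2)
  then show ?thesis using True assms by (simp add: refl_def max_def)
next
  case False
  have "cmod (cnj a * z) \<le> 1 * (1/2)" unfolding norm_mult using False assms by (intro mult_mono) auto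
  moreover have "1 - cmod (cnj a * z) \<le> cmod (1 - cnj a * z)" by (metis norm_one norm_triangle_ineq2)
  ultimately show ?thesis using False by (simp add: refl_def max_def)
qed

text \<open>Up to the constant \<open>m i\<close>, a reflected factor is |1 - b i * w| with |b i|
  \<le> 1, hence zero-free in the open disc. Its real powers are moduli of holomorphic functions
  there, and \<open>poisson_bound\<close> applies to their product.\<close>

lemma poisson_majorant:
  fixes a :: "'i \<Rightarrow> complex" and q :: "'i \<Rightarrow> real"
  assumes fin: "finite I" and q: "\<And>i. i \<in> I \<Longrightarrow> q i > 0" and z: "cmod z < 1"
  shows "(\<Prod>i\<in>I. refl (a i) z powr q i) \<le>
    integral {0..1} (\<lambda>x. (\<Prod>i\<in>I. cmod (circ x - a i) powr q i) * pois z (circ x))"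
proof -
  define b where "b i = (if cmod (a i) \<ge> 1 then 1 / a i else cnj (a i))" for i
  define m where "m i = (if cmod (a i) \<ge> 1 then cmod (a i) else 1)" for i
  have b1: "cmod (b i) \<le> 1" for i by (auto simp: b_def norm_divide divide_simps)
  have refl_b: "refl (a i) w = m i * cmod (1 - b i * w)" for i w
  proof (cases "cmod (a i) \<ge> 1")
    case True
    then have "a i \<noteq> 0" by auto
    then have "w - a i = - a i * (1 - b i * w)" using True by (simp add: b_def field_simps)
    then have "cmod (w - a i) = cmod (a i) * cmod (1 - b i * w)" by (simp only: norm_mult norm_minus_cancel)
    then show ?thesis using True by (simp add: refl_def m_def)
  qed (simp add: refl_def b_def m_def)
  have m0: "m i \<ge> 0" for i by (simp add: m_def)
  \<comment> \<open>A dilation with s < 1 moves zeros on the unit circle off the closed disc, so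
    that the principal logarithm can be used. The limit s = 1 relies on the continuity of
    \<open>powr\<close> at base 0, hence on positive exponents.\<close>
  define U where "U s w = (\<Prod>i\<in>I. cmod (1 - of_real s * b i * w) powr q i)" for s :: real and w
  have contU: "continuous_on S (\<lambda>x. U (f x) (g x))" if "continuous_on S f" "continuous_on S g" for S :: "'x::t2_space set" and f g
    unfolding U_def using q that by (intro continuous_intros continuous_on_powr') (auto intro!: order.strict_implies_order)
  have ineq: "U s z \<le> integral {0..1} (\<lambda>x. U s (circ x) * pois z (circ x))" if s: "0 \<le> s" "s < 1" for s
  proof -
    define F where "F w = (\<Prod>i\<in>I. exp (of_real (q i) * Ln (1 - of_real s * b i * w)))" for w
    have small: "cmod (of_real s * b i * w) < 1" if "cmod w \<le> 1" for i w
    proof -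
      have "cmod (of_real s * b i * w) = s * (cmod (b i) * cmod w)" using s by (simp add: norm_mult)
      also have "\<dots> \<le> s * (1 * 1)" using b1[of i] that s by (intro mult_left_mono mult_mono) auto
      finally show ?thesis using s by simp
    qed
    have nonneg: "1 - of_real s * b i * w \<notin> \<real>\<^sub>\<le>\<^sub>0" if "cmod w \<le> 1" for i w
    proof
      assume "1 - of_real s * b i * w \<in> \<real>\<^sub>\<le>\<^sub>0"
      then have "Re (1 - of_real s * b i * w) \<le> 0" by (simp add: complex_nonpos_Reals_iff)
      moreover have "Re (of_real s * b i * w) < 1"
        using small[OF that] complex_Re_le_cmod by (rule le_less_trans[rotated])
      ultimately show False by simp
    qed
    have cmodF: "cmod (F w) = U s w" if "cmod w \<le> 1" for w
    proof -
      have "cmod (exp (of_real (q i) * Ln (1 - of_real s * b i * w))) = cmod (1 - of_real s * b i * w) powr q i" for i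
      proof -
        have "1 - of_real s * b i * w \<noteq> 0" using nonneg[OF that, of i] by auto
        then show ?thesis by (simp add: powr_def)
      qed
      then show ?thesis unfolding F_def U_def by (simp add: prod_norm[symmetric])
    qed
    have "F holomorphic_on cball 0 1"
      unfolding F_def using nonneg by (intro holomorphic_intros) auto
    then have "continuous_on (cball 0 1) F" "F holomorphic_on ball 0 1"
      using holomorphic_on_imp_continuous_on holomorphic_on_subset[OF _ ball_subset_cball] by blast+
    from poisson_bound[OF this z] show ?thesis
      using z by (simp add: cmodF)
  qed
  have "continuous_on {0..1} (\<lambda>s. integral (cbox 0 1) (\<lambda>x. U s (circ x) * pois z (circ x)))"
    by (rule integral_continuous_on_param)
       (use z in \<open>auto simp: case_prod_unfold intro!: continuous_intros contU\<close>)
  then have c1: "continuous_on {0..1} (\<lambda>s. integral {0..1} (\<lambda>x. U s (circ x) * pois z (circ x)))"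
    by simp
  have c2: "continuous_on {0..1} (\<lambda>s. U s z)" by (intro contU continuous_intros)
  have lim: "U 1 z \<le> integral {0..1} (\<lambda>x. U 1 (circ x) * pois z (circ x))"
  proof (rule tendsto_le[of "at_left 1"])
    show "((\<lambda>s. integral {0..1} (\<lambda>x. U s (circ x) * pois z (circ x))) \<longlongrightarrow>
      integral {0..1} (\<lambda>x. U 1 (circ x) * pois z (circ x))) (at_left 1)"
      by (rule continuous_on_Icc_at_leftD[OF c1]) simp
    show "((\<lambda>s. U s z) \<longlongrightarrow> U 1 z) (at_left 1)"
      by (rule continuous_on_Icc_at_leftD[OF c2]) simp
    show "\<forall>\<^sub>F s in at_left 1. U s z \<le> integral {0..1} (\<lambda>x. U s (circ x) * pois z (circ x))"
      by (rule eventually_at_leftI[of 0]) (use ineq in auto)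
  qed simp
  have prod_refl: "(\<Prod>i\<in>I. refl (a i) w powr q i) = (\<Prod>i\<in>I. m i powr q i) * U 1 w" for w
    unfolding refl_b U_def using m0 by (simp add: powr_mult prod.distrib)
  have "(\<Prod>i\<in>I. refl (a i) z powr q i) \<le>
      (\<Prod>i\<in>I. m i powr q i) * integral {0..1} (\<lambda>x. U 1 (circ x) * pois z (circ x))"
    unfolding prod_refl using lim by (intro mult_left_mono prod_nonneg) auto
  also have "\<dots> = integral {0..1} (\<lambda>x. (\<Prod>i\<in>I. cmod (circ x - a i) powr q i) * pois z (circ x))"
    unfolding integral_mult_right[symmetric] mult.assoc[symmetric] prod_refl[symmetric] refl_circ ..
  finally show ?thesis .
qed

section \<open>Local and mean bounds for a power of |G| times the endpoint factors\<close>

definition wmod :: "complex poly \<Rightarrow> real \<Rightarrow> real \<Rightarrow> real \<Rightarrow> complex \<Rightarrow> real" where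
  "wmod G p a b z = cmod (poly G z) powr p * cmod (z - 1) powr a * cmod (z + 1) powr b"

lemma wmod_nonneg: "wmod G p a b z \<ge> 0"
  by (simp add: wmod_def)

lemma continuous_on_wmod:
  assumes "p > 0" "a > 0" "b > 0" "continuous_on S f"
  shows "continuous_on S (\<lambda>x. wmod G p a b (f x))"
  unfolding wmod_def using assms
  by (intro continuous_intros continuous_on_powr') auto

lemma complex_poly_factorization:
  fixes G :: "complex poly"
  shows "\<exists>(m::nat) r. \<forall>z. poly G z = lead_coeff G * (\<Prod>i<m. z - r i)"
proof (induction "degree G" arbitrary: G)
  case 0
  then obtain c where "G = [:c:]" by (metis degree_eq_zeroE)
  then show ?case by (intro exI[of _ 0]) simp
next
  case (Suc d)
  obtain w where w: "poly G w = 0"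
  proof (rule fundamental_theorem_of_algebra[of "coeff G" "degree G"])
    have "coeff G (degree G) \<noteq> 0" using Suc.hyps(2) by auto
    then show "coeff G 0 = 0 \<or> (\<exists>i\<in>{1..degree G}. coeff G i \<noteq> 0)"
      using Suc.hyps(2) by (intro disjI2 bexI[of _ "degree G"]) auto
  qed (simp add: poly_altdef that)
  then obtain H where H: "G = [:-w, 1:] * H" by (auto simp: poly_eq_0_iff_dvd)
  then have "H \<noteq> 0" using Suc.hyps(2) by auto
  then have "degree G = Suc (degree H)" unfolding H by (subst degree_mult_eq) auto
  then obtain m :: nat and r where r: "\<And>z. poly H z = lead_coeff H * (\<Prod>i<m. z - r i)"
    using Suc by (metis Suc_inject)
  have "lead_coeff G = lead_coeff H" unfolding H lead_coeff_mult by simp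
  then have "poly G z = lead_coeff G * (\<Prod>i<Suc m. z - (r(m := w)) i)" for z
    by (simp add: H r algebra_simps)
  then show ?case by blast
qed

text \<open>The map c + \<tau> z carries the disc to the unit one; the roots of G, with 1 and -1
  appended under the exponents a and b, become the points \<open>s i\<close> of
  \<open>poisson_majorant\<close>. In the second bound only the factors of G are compared by
  \<open>refl_ge\<close>. The endpoint factors use \<open>refl_ge_half\<close> instead, and so are
  bounded through c, \<tau> alone and not at c + \<tau> \<zeta>, where they may vanish.\<close>

lemma wmod_majorant:
  assumes pos: "p > 0" "a > 0" "b > 0" and tau: "\<tau> \<noteq> 0" and z: "cmod \<zeta> < 1"
  shows "wmod G p a b (c + \<tau> * \<zeta>) \<le> integral {0..1} (\<lambda>x. wmod G p a b (c + \<tau> * circ x) * pois \<zeta> (circ x))"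
    and "cmod \<zeta> \<le> 1/2 \<Longrightarrow>
      cmod (poly G (c + \<tau> * \<zeta>)) powr p * (max (cmod \<tau>) (cmod (c - 1)) / 2) powr a
         * (max (cmod \<tau>) (cmod (c + 1)) / 2) powr b
      \<le> integral {0..1} (\<lambda>x. wmod G p a b (c + \<tau> * circ x) * pois \<zeta> (circ x))"
proof -
  obtain m :: nat and r where r: "\<And>z. poly G z = lead_coeff G * (\<Prod>i<m. z - r i)"
    using complex_poly_factorization[of G] by blast
  define l where "l = lead_coeff G"
  define A where "A i = (if i < m then r i else if i = m then 1 else -1)" for i
  define q where "q i = (if i < m then p else if i = m then a else b)" for i
  define s where "s i = (A i - c) / \<tau>" for i
  define t where "t = cmod \<tau>"
  define I where "I = {..<Suc (Suc m)}"
  have t: "t > 0" using tau by (simp add: t_def)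
  have q: "q i > 0" for i using pos by (simp add: q_def)
  have split: "(\<Prod>i\<in>I. f (A i) (q i)) = (\<Prod>i<m. f (r i) p) * f 1 a * f (-1) b" for f :: "complex \<Rightarrow> real \<Rightarrow> real"
  proof -
    have "(\<Prod>i<m. f (A i) (q i)) = (\<Prod>i<m. f (r i) p)"
      by (rule prod.cong) (auto simp: A_def q_def)
    then show ?thesis by (simp add: I_def) (simp add: A_def q_def)
  qed
  have absG: "cmod (poly G w) powr p = cmod l powr p * (\<Prod>i<m. cmod (w - r i) powr p)" for w
    by (simp add: r l_def[symmetric] norm_mult powr_mult prod_norm[symmetric] prod_powr_distrib)
  have v: "wmod G p a b w = cmod l powr p * (\<Prod>i\<in>I. cmod (w - A i) powr q i)" for w
    unfolding split[of "\<lambda>x y. cmod (w - x) powr y"] wmod_def absG by simp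
  have node: "cmod (c + \<tau> * w - A i) = t * cmod (w - s i)" for w i
  proof -
    have "c + \<tau> * w - A i = \<tau> * (w - s i)" using tau by (simp add: s_def field_simps)
    then show ?thesis by (simp add: norm_mult t_def)
  qed
  define K where "K = cmod l powr p * (\<Prod>i\<in>I. t powr q i)"
  have K: "K \<ge> 0" unfolding K_def by (intro mult_nonneg_nonneg prod_nonneg) auto
  have v': "wmod G p a b (c + \<tau> * w) = K * (\<Prod>i\<in>I. cmod (w - s i) powr q i)" for w
    unfolding v node K_def using t by (simp add: powr_mult prod.distrib)
  have "K * (\<Prod>i\<in>I. refl (s i) \<zeta> powr q i) \<le> K * integral {0..1} (\<lambda>x. (\<Prod>i\<in>I. cmod (circ x - s i) powr q i) * pois \<zeta> (circ x))"
    using K q z by (intro mult_left_mono poisson_majorant) (auto simp: I_def)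
  also have "\<dots> = integral {0..1} (\<lambda>x. wmod G p a b (c + \<tau> * circ x) * pois \<zeta> (circ x))"
    unfolding v' by (simp add: mult.assoc)
  finally have main: "K * (\<Prod>i\<in>I. refl (s i) \<zeta> powr q i) \<le> \<dots>" .
  have "wmod G p a b (c + \<tau> * \<zeta>) \<le> K * (\<Prod>i\<in>I. refl (s i) \<zeta> powr q i)"
    unfolding v' using K q z
    by (intro mult_left_mono prod_mono conjI powr_mono2 refl_ge) (auto intro: less_imp_le)
  with main show "wmod G p a b (c + \<tau> * \<zeta>) \<le> integral {0..1} (\<lambda>x. wmod G p a b (c + \<tau> * circ x) * pois \<zeta> (circ x))"
    by linarith
  assume z2: "cmod \<zeta> \<le> 1/2"
  have far: "(max t (cmod (c - y)) / 2) \<le> t * refl ((y - c) / \<tau>) \<zeta>" for y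
  proof -
    have "max t (cmod (c - y)) / 2 = t * (max 1 (cmod ((y - c) / \<tau>)) / 2)"
      using t by (simp add: max_def norm_divide t_def[symmetric] norm_minus_commute field_simps)
    also have "\<dots> \<le> t * refl ((y - c) / \<tau>) \<zeta>" using t z2 by (intro mult_left_mono refl_ge_half) auto
    finally show ?thesis .
  qed
  have "K * (\<Prod>i\<in>I. refl (s i) \<zeta> powr q i) = cmod l powr p * (\<Prod>i\<in>I. (t * refl (s i) \<zeta>) powr q i)"
    unfolding K_def using t by (simp add: powr_mult prod.distrib refl_nonneg)
  also have "\<dots> = cmod l powr p * (\<Prod>i<m. (t * refl ((r i - c) / \<tau>) \<zeta>) powr p)
     * (t * refl ((1 - c) / \<tau>) \<zeta>) powr a * (t * refl ((- 1 - c) / \<tau>) \<zeta>) powr b"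
    unfolding s_def using split[of "\<lambda>x y. (t * refl ((x - c) / \<tau>) \<zeta>) powr y"] by simp
  also have "\<dots> \<ge> cmod l powr p * (\<Prod>i<m. cmod (c + \<tau> * \<zeta> - r i) powr p)
     * (max t (cmod (c - 1)) / 2) powr a * (max t (cmod (c + 1)) / 2) powr b"
  proof (intro mult_mono powr_mono2 order.refl prod_mono conjI)
    show "cmod (c + \<tau> * \<zeta> - r i) \<le> t * refl ((r i - c) / \<tau>) \<zeta>" if "i \<in> {..<m}" for i
    proof -
      have "cmod (c + \<tau> * \<zeta> - r i) = t * cmod (\<zeta> - (r i - c) / \<tau>)"
        using node[of \<zeta> i] that by (simp add: s_def A_def)
      also have "\<dots> \<le> t * refl ((r i - c) / \<tau>) \<zeta>" using t z by (intro mult_left_mono refl_ge) auto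
      finally show ?thesis .
    qed
    show "max t (cmod (c + 1)) / 2 \<le> t * refl ((- 1 - c) / \<tau>) \<zeta>" using far[of "-1"] by simp
  qed (use pos t far[of 1] in \<open>auto simp: max_def intro!: mult_nonneg_nonneg prod_nonneg refl_nonneg\<close>)
  finally show "cmod (poly G (c + \<tau> * \<zeta>)) powr p * (max (cmod \<tau>) (cmod (c - 1)) / 2) powr a
         * (max (cmod \<tau>) (cmod (c + 1)) / 2) powr b
      \<le> integral {0..1} (\<lambda>x. wmod G p a b (c + \<tau> * circ x) * pois \<zeta> (circ x))"
    using main unfolding absG t_def by linarith
qed

text \<open>The factor 3 bounds the Poisson kernel on the half disc; 2 powr (a + b) clears the
  halves from \<open>refl_ge_half\<close>. The left side mixes G at c + \<tau> \<zeta> with the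
  endpoint factors at c on purpose: differences of a polynomial are weighted at their
  centre.\<close>

lemma wmod_local_bound:
  assumes pos: "p > 0" "a > 0" "b > 0" and tau: "\<tau> \<noteq> 0" and z: "cmod \<zeta> \<le> 1/2"
  shows "cmod (poly G (c + \<tau> * \<zeta>)) powr p * cmod (c - 1) powr a * cmod (c + 1) powr b
      \<le> 3 * 2 powr (a + b) * integral {0..1} (\<lambda>x. wmod G p a b (c + \<tau> * circ x))"
proof -
  have z1: "cmod \<zeta> < 1" using z by simp
  have "cmod (poly G (c + \<tau> * \<zeta>)) powr p * (cmod (c - 1) / 2) powr a * (cmod (c + 1) / 2) powr b \<le>
     cmod (poly G (c + \<tau> * \<zeta>)) powr p * (max (cmod \<tau>) (cmod (c - 1)) / 2) powr a
         * (max (cmod \<tau>) (cmod (c + 1)) / 2) powr b"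
    using pos by (intro mult_mono powr_mono2) auto
  also have "\<dots> \<le> integral {0..1} (\<lambda>x. wmod G p a b (c + \<tau> * circ x) * pois \<zeta> (circ x))"
    by (rule wmod_majorant(2)[OF pos tau z1 z])
  also have "\<dots> \<le> integral {0..1} (\<lambda>x. wmod G p a b (c + \<tau> * circ x) * 3)"
    using z1 z
    by (intro integral_le integrable_continuous_real continuous_intros continuous_on_wmod pos mult_left_mono pois_le_3 wmod_nonneg) auto
  finally have "cmod (poly G (c + \<tau> * \<zeta>)) powr p * (cmod (c - 1) / 2) powr a * (cmod (c + 1) / 2) powr b
     \<le> 3 * integral {0..1} (\<lambda>x. wmod G p a b (c + \<tau> * circ x))" by simp
  then show ?thesis
    by (simp add: powr_divide powr_add field_simps)
qed

text \<open>Conjugation and multiplication by the unimodular number circ x * circ y interchange the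
  two angles. Hence the kernel also has mass 1 in the angle of its interior point, as needed after
  exchanging integrals.\<close>

lemma pois_swap: "pois (w * circ y) (circ x) = pois (cnj w * circ x) (circ y)"
proof -
  have "cmod (circ x - w * circ y) = cmod (cnj (circ x - w * circ y) * (circ x * circ y))"
    by (simp only: norm_mult complex_mod_cnj norm_circ mult_1_right)
  also have "cnj (circ x - w * circ y) * (circ x * circ y)
     = (cnj (circ x) * circ x) * circ y - cnj w * (cnj (circ y) * circ y) * circ x"
    by (simp only: complex_cnj_diff complex_cnj_mult) (simp only: algebra_simps)
  finally show ?thesis by (simp add: pois_def norm_mult)
qed

text \<open>Integrating the majorant over y and exchanging the integrals leaves the mass of the
  kernel in y, which is 1 by \<open>pois_swap\<close>.\<close>

lemma hardy_mean_le:
  assumes pos: "p > 0" "a > 0" "b > 0" and w: "cmod w \<le> 1"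
  shows "integral {0..1} (\<lambda>y. wmod G p a b (w * circ y)) \<le> integral {0..1} (\<lambda>y. wmod G p a b (circ y))"
proof -
  have open_case: "integral {0..1} (\<lambda>y. wmod G p a b (w * circ y)) \<le> integral {0..1} (\<lambda>y. wmod G p a b (circ y))"
    if w: "cmod w < 1" for w
  proof -
    have w': "cmod (w * circ y) < 1" for y using w by (simp add: norm_mult)
    have cont: "continuous_on S (\<lambda>z. wmod G p a b (circ (f z)) * pois (w * circ (g z)) (circ (f z)))"
      if "continuous_on S f" "continuous_on S g" for S :: "'x::t2_space set" and f g
      unfolding pois_def using w'
      by (intro continuous_intros continuous_on_wmod pos that)
         (metis eq_iff_diff_eq_0 less_irrefl norm_circ power_eq_0_iff norm_eq_zero)
    have "integral {0..1} (\<lambda>y. wmod G p a b (w * circ y)) \<le>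
      integral {0..1} (\<lambda>y. integral {0..1} (\<lambda>x. wmod G p a b (circ x) * pois (w * circ y) (circ x)))"
    proof (rule integral_le)
      show "(\<lambda>y. wmod G p a b (w * circ y)) integrable_on {0..1}"
        by (intro integrable_continuous_real continuous_on_wmod continuous_intros pos)
      have "continuous_on {0..1} (\<lambda>y. integral (cbox 0 1) (\<lambda>x. wmod G p a b (circ x) * pois (w * circ y) (circ x)))"
        by (rule integral_continuous_on_param) (auto simp: case_prod_unfold intro!: continuous_intros cont)
      then show "(\<lambda>y. integral {0..1} (\<lambda>x. wmod G p a b (circ x) * pois (w * circ y) (circ x))) integrable_on {0..1}"
        by (intro integrable_continuous_real) simp
      show "wmod G p a b (w * circ y) \<le> integral {0..1} (\<lambda>x. wmod G p a b (circ x) * pois (w * circ y) (circ x))" for y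
        using wmod_majorant(1)[OF pos, of 1 "w * circ y" G 0] w' by simp
    qed
    also have "\<dots> = integral {0..1} (\<lambda>x. integral {0..1} (\<lambda>y. wmod G p a b (circ x) * pois (w * circ y) (circ x)))"
      using integral_swap_continuous[of 0 0 1 1 "\<lambda>y x. wmod G p a b (circ x) * pois (w * circ y) (circ x)"]
      by (simp add: case_prod_unfold cont continuous_intros)
    also have "\<dots> = integral {0..1} (\<lambda>x. wmod G p a b (circ x))"
    proof -
      have "(\<lambda>y. pois (w * circ y) (circ x)) = (\<lambda>y. pois (cnj w * circ x) (circ y))" for x
        by (rule ext) (rule pois_swap)
      then have "integral {0..1} (\<lambda>y. pois (w * circ y) (circ x)) = 1" for x
        using w by (simp add: integral_pois norm_mult)
      then show ?thesis by simp
    qed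
    finally show ?thesis .
  qed
  have "continuous_on {0..1} (\<lambda>s. integral (cbox 0 1) (\<lambda>y. wmod G p a b (of_real s * w * circ y)))"
    by (rule integral_continuous_on_param) (auto simp: case_prod_unfold intro!: continuous_intros continuous_on_wmod pos)
  then have c1: "continuous_on {0..1} (\<lambda>s. integral {0..1} (\<lambda>y. wmod G p a b (of_real s * w * circ y)))"
    by simp
  have "((\<lambda>s. integral {0..1} (\<lambda>y. wmod G p a b (of_real s * w * circ y))) \<longlongrightarrow>
      integral {0..1} (\<lambda>y. wmod G p a b (of_real 1 * w * circ y))) (at_left 1)"
    by (rule continuous_on_Icc_at_leftD[OF c1]) simp
  moreover have "\<forall>\<^sub>F s in at_left 1. integral {0..1} (\<lambda>y. wmod G p a b (of_real s * w * circ y))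
      \<le> integral {0..1} (\<lambda>y. wmod G p a b (circ y))"
  proof (rule eventually_at_leftI[of 0])
    fix s :: real assume s: "s \<in> {0<..<1}"
    have "cmod (of_real s * w) \<le> s * 1" unfolding norm_mult using s w by (intro mult_mono) auto
    then show "integral {0..1} (\<lambda>y. wmod G p a b (of_real s * w * circ y)) \<le> integral {0..1} (\<lambda>y. wmod G p a b (circ y))"
      using s by (intro open_case) auto
  qed simp
  ultimately show ?thesis
    using tendsto_upperbound[OF _ _ trivial_limit_at_left_real] by fastforce
qed

section \<open>Lifting polynomials to the unit circle\<close>

text \<open>This is z^d P((z + 1/z)/2) with d the degree of P. The denominators are cleared term by
  term, as ((1 + z^2)/2)^i z^(d - i), so that the result is a genuine polynomial.\<close>

definition circ_lift :: "real poly \<Rightarrow> complex poly" where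
  "circ_lift P = (\<Sum>i\<le>degree P. smult (of_real (coeff P i)) ([:1/2, 0, 1/2:] ^ i * monom 1 (degree P - i)))"

lemma poly_circ_lift:
  assumes "z \<noteq> 0"
  shows "poly (circ_lift P) z = z ^ degree P * poly (map_poly of_real P) ((z + 1 / z) / 2)"
proof -
  have tm: "poly [:1/2, 0, 1/2:] z ^ i * z ^ (degree P - i) = z ^ degree P * ((z + 1 / z) / 2) ^ i"
    if "i \<le> degree P" for i
  proof -
    have "poly [:1/2, 0, 1/2:] z = z * ((z + 1 / z) / 2)"
      using assms by (simp add: field_simps)
    then have "poly [:1/2, 0, 1/2:] z ^ i * z ^ (degree P - i) = z ^ (i + (degree P - i)) * ((z + 1 / z) / 2) ^ i"
      by (simp only: power_mult_distrib power_add mult_ac)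
    then show ?thesis using that by simp
  qed
  have "poly (circ_lift P) z = (\<Sum>i\<le>degree P. of_real (coeff P i) * (z ^ degree P * ((z + 1 / z) / 2) ^ i))"
    unfolding circ_lift_def poly_sum poly_smult poly_mult poly_power poly_monom
    by (intro sum.cong refl) (simp only: tm mult_1_left atMost_iff)
  also have "\<dots> = z ^ degree P * (\<Sum>i\<le>degree P. of_real (coeff P i) * ((z + 1 / z) / 2) ^ i)"
    by (simp add: sum_distrib_left mult_ac)
  also have "(\<Sum>i\<le>degree P. of_real (coeff P i) * ((z + 1 / z) / 2) ^ i) = poly (map_poly of_real P) ((z + 1 / z) / 2)"
    by (simp add: poly_altdef coeff_map_poly degree_map_poly)
  finally show ?thesis .
qed

lemma wmod_circ_lift_cnj:
  assumes "z \<noteq> 0"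
  shows "wmod (circ_lift P) p a b (cnj z) = wmod (circ_lift P) p a b z"
proof -
  have "poly (map_poly of_real P) (cnj w) = cnj (poly (map_poly of_real P) w)" for w
    by (simp add: poly_altdef coeff_map_poly degree_map_poly)
  then have "poly (circ_lift P) (cnj z) = cnj (poly (circ_lift P) z)"
    using assms poly_circ_lift[of "cnj z" P] poly_circ_lift[of z P]
    by (metis (no_types, lifting) complex_cnj_add complex_cnj_divide complex_cnj_mult complex_cnj_numeral complex_cnj_one complex_cnj_power complex_cnj_zero_iff)
  moreover have "cmod (cnj z - 1) = cmod (z - 1)" "cmod (cnj z + 1) = cmod (z + 1)"
    by (metis complex_cnj_diff complex_cnj_one complex_mod_cnj)
       (metis complex_cnj_add complex_cnj_one complex_mod_cnj)
  ultimately show ?thesis by (simp add: wmod_def)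
qed

text \<open>The lift G satisfies G(z) = z^(2 d) G(1/z), and z - 1, z + 1 are self-reciprocal up to
  sign. Circles outside the unit disc can therefore be exchanged for circles inside, at the price of
  a power of the radius.\<close>

lemma wmod_circ_lift_inverse:
  assumes "z \<noteq> 0" "p > 0"
  shows "wmod (circ_lift P) p a b z = cmod z powr (2 * real (degree P) * p + a + b) * wmod (circ_lift P) p a b (1 / z)"
proof -
  have "poly (circ_lift P) z = z ^ (2 * degree P) * poly (circ_lift P) (1 / z)"
    using assms by (simp add: poly_circ_lift mult_2 power_add add.commute power_divide)
  moreover have "z - 1 = z * - (1 / z - 1)" "z + 1 = z * (1 / z + 1)" using assms by (auto simp: field_simps)
  then have "cmod (z - 1) = cmod z * cmod (1 / z - 1)" "cmod (z + 1) = cmod z * cmod (1 / z + 1)"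
    by (metis norm_minus_cancel norm_mult)+
  ultimately show ?thesis using assms
    by (simp add: wmod_def norm_mult norm_power powr_mult powr_add powr_powr flip: powr_realpow)
qed

text \<open>Inside the disc this is \<open>hardy_mean_le\<close>. Outside, inversion costs |w| powr
  D with D = 2 d p + a + b \<le> n (2 p + a + b), and (1 + 1/n) powr D \<le> exp (D / n). Circles
  reaching no further than 1/n beyond the unit circle thus cost a factor independent of n.\<close>

lemma mean_wmod_le:
  assumes pos: "p > 0" "a > 0" "b > 0" and n: "degree P < n" and w: "cmod w \<le> 1 + 1 / n"
  shows "integral {0..1} (\<lambda>y. wmod (circ_lift P) p a b (w * circ y))
    \<le> exp (2 * p + a + b) * integral {0..1} (\<lambda>y. wmod (circ_lift P) p a b (circ y))"
proof -
  let ?v = "wmod (circ_lift P) p a b"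
  have M0: "integral {0..1} (\<lambda>y. ?v (circ y)) \<ge> 0"
    by (intro integral_nonneg integrable_continuous_real continuous_on_wmod continuous_intros pos wmod_nonneg)
  show ?thesis
  proof (cases "cmod w \<le> 1")
    case True
    then have "integral {0..1} (\<lambda>y. ?v (w * circ y)) \<le> integral {0..1} (\<lambda>y. ?v (circ y))"
      by (rule hardy_mean_le[OF pos])
    also have "\<dots> \<le> exp (2 * p + a + b) * integral {0..1} (\<lambda>y. ?v (circ y))"
      using M0 pos mult_right_mono[of 1 "exp (2 * p + a + b)"] by simp
    finally show ?thesis .
  next
    case False
    define D where "D = 2 * real (degree P) * p + a + b"
    have w0: "w \<noteq> 0" using False by auto
    have refl: "?v (w * circ y) = cmod w powr D * ?v (cnj (1 / w) * circ y)" for y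
    proof -
      have "?v (w * circ y) = cmod w powr D * ?v (1 / (w * circ y))"
        using wmod_circ_lift_inverse[of "w * circ y" p P a b] w0 pos by (simp add: D_def norm_mult)
      \<comment> \<open>Inversion reverses the sense of rotation in y. Conjugation restores it, so
        that the point is again a constant times \<open>circ y\<close>.\<close>
      also have "?v (1 / (w * circ y)) = ?v (cnj (1 / (w * circ y)))"
        using w0 by (intro wmod_circ_lift_cnj[symmetric]) auto
      also have "cnj (1 / (w * circ y)) = cnj (1 / w) * circ y"
        using cnj_circ_mult(1)[of y] w0 by (simp add: field_simps)
      finally show ?thesis .
    qed
    have "integral {0..1} (\<lambda>y. ?v (w * circ y)) = cmod w powr D * integral {0..1} (\<lambda>y. ?v (cnj (1 / w) * circ y))"
      by (simp only: refl integral_mult_right)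
    also have "\<dots> \<le> exp (2 * p + a + b) * integral {0..1} (\<lambda>y. ?v (circ y))"
    proof (rule mult_mono)
      have "cmod w powr D \<le> (exp (1 / n)) powr D"
        using order.trans[OF w exp_ge_add_one_self] pos by (intro powr_mono2) (auto simp: D_def)
      also have "\<dots> = exp (D / n)" by (simp add: powr_def field_simps)
      also have "D / n \<le> 2 * p + a + b"
      proof -
        have "D \<le> 2 * real n * p + a * real n + b * real n"
          unfolding D_def using n pos by (intro add_mono mult_right_mono) auto
        then show ?thesis using n by (simp add: field_simps)
      qed
      finally show "cmod w powr D \<le> exp (2 * p + a + b)" by simp
      show "integral {0..1} (\<lambda>y. ?v (cnj (1 / w) * circ y)) \<le> integral {0..1} (\<lambda>y. ?v (circ y))"
        using False by (intro hardy_mean_le pos) (simp add: norm_divide divide_simps)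
      show "0 \<le> integral {0..1} (\<lambda>y. ?v (cnj (1 / w) * circ y))"
        by (intro integral_nonneg integrable_continuous_real continuous_on_wmod continuous_intros pos wmod_nonneg)
    qed simp
    finally show ?thesis .
  qed
qed

text \<open>The two preimages z1, z2 of y have product 1, and (z1 - u) (z2 - u) = -2 u (y - Re u)
  has modulus at most 2 \<epsilon> |Im u|, while |z1 - u| + |z2 - u| \<ge> |Im u|. So one preimage
  is at distance at least |Im u| / 2 from u, which forces the other within 4 \<epsilon>. Avoiding a
  local inverse keeps the bound uniform up to u = 1 and u = -1, where the derivative of the map
  vanishes.\<close>

lemma zhukovsky_preimage:
  assumes u: "cmod u = 1" and y: "cmod (y - of_real (Re u)) \<le> \<epsilon> * \<bar>Im u\<bar>" and e: "0 \<le> \<epsilon>" "\<epsilon> \<le> 1/2"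
  shows "\<exists>z. z \<noteq> 0 \<and> y = (z + 1 / z) / 2 \<and> cmod (z - u) \<le> 4 * \<epsilon>"
proof (cases "Im u = 0")
  case True
  have "u \<noteq> 0" using u by auto
  moreover have "y = u" using y True by (simp add: complex_eq_iff)
  moreover have "u * u = 1"
    using u True by (cases u) (auto simp: complex_eq_iff cmod_def abs_square_eq_1 simp flip: power2_eq_square)
  then have "1 / u = u" using \<open>u \<noteq> 0\<close> by (simp add: field_simps)
  ultimately show ?thesis using e by (intro exI[of _ u]) auto
next
  case False
  define s where "s = csqrt (y\<^sup>2 - 1)"
  define z1 where "z1 = y + s"
  define z2 where "z2 = y - s"
  have s2: "s\<^sup>2 = y\<^sup>2 - 1" by (simp add: s_def)
  have z12: "z1 * z2 = 1" using s2 by (simp add: z1_def z2_def algebra_simps power2_eq_square)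
  have uu: "u\<^sup>2 + 1 = 2 * of_real (Re u) * u"
  proof -
    have "u * cnj u = 1" using complex_norm_square[of u] u by simp
    moreover have "u + cnj u = 2 * of_real (Re u)" by (simp add: complex_eq_iff)
    ultimately show ?thesis
      by (metis (no_types) distrib_left power2_eq_square mult.commute)
  qed
  have prod: "(z1 - u) * (z2 - u) = - 2 * u * (y - of_real (Re u))"
  proof -
    have "(z1 - u) * (z2 - u) = z1 * z2 - 2 * y * u + u\<^sup>2"
      by (simp add: z1_def z2_def algebra_simps power2_eq_square)
    also have "\<dots> = - 2 * u * (y - of_real (Re u))" using uu z12 by (simp add: algebra_simps)
    finally show ?thesis .
  qed
  have P: "cmod (z1 - u) * cmod (z2 - u) \<le> 2 * \<epsilon> * \<bar>Im u\<bar>"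
    using y u by (simp flip: norm_mult add: prod) (simp add: norm_mult)
  have sum: "(z1 - u) + (z2 - u) = 2 * (y - of_real (Re u)) - 2 * \<i> * of_real (Im u)"
    by (simp add: z1_def z2_def complex_eq_iff)
  have S: "cmod (z1 - u) + cmod (z2 - u) \<ge> \<bar>Im u\<bar>"
  proof -
    have "\<bar>Im u\<bar> \<le> 2 * \<bar>Im u\<bar> - 2 * (\<epsilon> * \<bar>Im u\<bar>)" using mult_right_mono[OF e(2), of "\<bar>Im u\<bar>"] by simp
    also have "\<dots> \<le> cmod (2 * \<i> * of_real (Im u)) - cmod (2 * (y - of_real (Re u)))"
      unfolding norm_mult using y by simp
    also have "\<dots> \<le> cmod ((z1 - u) + (z2 - u))"
      unfolding sum by (metis norm_minus_commute norm_triangle_ineq2)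
    also have "\<dots> \<le> cmod (z1 - u) + cmod (z2 - u)" by (rule norm_triangle_ineq)
    finally show ?thesis .
  qed
  have key: "\<exists>z. z \<noteq> 0 \<and> y = (z + 1 / z) / 2 \<and> cmod (z - u) \<le> 4 * \<epsilon>"
    if far: "cmod (z' - u) \<ge> \<bar>Im u\<bar> / 2" and zz: "z * z' = 1" and y2: "y = (z + z') / 2"
      and pr: "cmod (z - u) * cmod (z' - u) \<le> 2 * \<epsilon> * \<bar>Im u\<bar>" for z z'
  proof (intro exI conjI)
    show "z \<noteq> 0" using zz by auto
    then have "z' = 1 / z" using zz by (simp add: field_simps)
    then show "y = (z + 1 / z) / 2" using y2 by simp
    have "cmod (z - u) * (\<bar>Im u\<bar> / 2) \<le> cmod (z - u) * cmod (z' - u)"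
      using far by (rule mult_left_mono) simp
    also note pr
    finally have "cmod (z - u) * \<bar>Im u\<bar> \<le> (4 * \<epsilon>) * \<bar>Im u\<bar>" by simp
    then show "cmod (z - u) \<le> 4 * \<epsilon>" using False by simp
  qed
  consider "cmod (z2 - u) \<ge> \<bar>Im u\<bar> / 2" | "cmod (z1 - u) \<ge> \<bar>Im u\<bar> / 2" using S by linarith
  then show ?thesis
  proof cases
    case 1
    then show ?thesis by (rule key[OF _ z12 _ P]) (simp add: z1_def z2_def)
  next
    case 2
    then show ?thesis
      by (rule key[of z1 z2]) (use z12 P in \<open>simp_all add: z1_def z2_def mult.commute\<close>)
  qed
qed

text \<open>Taking \<epsilon> = 1 / (8 n) in \<open>zhukovsky_preimage\<close> gives |z - u| \<le> 1
  / (2 n), half of the radius 1 / n, as \<open>wmod_local_bound\<close> requires. The factor 2 pays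
  for z^d in the lift: |z| ^ d \<ge> 1/2, by Bernoulli's inequality when |z| < 1.\<close>

lemma poly_le_circ_lift:
  assumes u: "cmod u = 1" and n: "degree P < n" and \<zeta>: "cmod \<zeta> \<le> \<bar>Im u\<bar> / (8 * n)"
  shows "\<exists>\<xi>. cmod \<xi> \<le> 1/2 \<and>
    cmod (poly (map_poly of_real P) (of_real (Re u) + \<zeta>)) \<le> 2 * cmod (poly (circ_lift P) (u + u / n * \<xi>))"
proof -
  have n1: "real n \<ge> 1" using n by simp
  have u0: "u \<noteq> 0" using u by auto
  obtain z where z: "z \<noteq> 0" "of_real (Re u) + \<zeta> = (z + 1 / z) / 2" "cmod (z - u) \<le> 4 * (1 / (8 * n))"
    using zhukovsky_preimage[OF u, of "of_real (Re u) + \<zeta>" "1 / (8 * n)"] \<zeta> n1 by (auto simp: field_simps)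
  define \<xi> where "\<xi> = (z - u) * n / u"
  have "u + u / n * \<xi> = z" unfolding \<xi>_def using u0 n1 by (simp add: field_simps)
  moreover have "cmod \<xi> = cmod (z - u) * n" unfolding \<xi>_def using u by (simp add: norm_mult norm_divide)
  then have "cmod \<xi> \<le> 1/2" using mult_right_mono[OF z(3), of n] n1 by simp
  moreover have "cmod (poly (map_poly of_real P) (of_real (Re u) + \<zeta>)) \<le> 2 * cmod (poly (circ_lift P) z)"
  proof -
    have zn: "cmod z \<ge> 1 - 1 / (2 * n)" using z(3) u norm_triangle_ineq2[of u z] by (simp add: norm_minus_commute)
    have "1 / 2 \<le> cmod z ^ degree P"
    proof (cases "cmod z \<ge> 1")
      case True
      then have "1 \<le> cmod z ^ degree P" by (rule one_le_power)
      then show ?thesis by simp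
    next
      case False
      have "1 / 2 = 1 + n * (- (1 / (2 * n)))" using n1 by simp
      also have "\<dots> \<le> (1 + (- (1 / (2 * n)))) ^ n"
        using n1 by (intro Bernoulli_inequality) (simp add: field_simps)
      also have "\<dots> \<le> cmod z ^ n" using zn n1 by (intro power_mono) (auto simp: field_simps)
      also have "\<dots> \<le> cmod z ^ degree P" using False n by (intro power_decreasing) auto
      finally show ?thesis .
    qed
    then have "1 / 2 * cmod (poly (map_poly of_real P) (of_real (Re u) + \<zeta>))
      \<le> cmod z ^ degree P * cmod (poly (map_poly of_real P) (of_real (Re u) + \<zeta>))"
      by (rule mult_right_mono) simp
    then show ?thesis using z(1) by (simp add: poly_circ_lift norm_mult norm_power z(2))
  qed
  ultimately show ?thesis by metis
qed

text \<open>The circle of radius 1/n about u is written as (1 + circ x / n) * u because, for fixed x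
  and varying u, these points form a circle about 0 of radius at most 1 + 1/n. Integrating over u
  thus leads to \<open>mean_wmod_le\<close>.\<close>

lemma poly_disc_bound:
  assumes pos: "p > 0" "a > 0" "b > 0" and u: "cmod u = 1" and n: "degree P < n"
    and \<zeta>: "cmod \<zeta> \<le> \<bar>Im u\<bar> / (8 * n)"
  shows "cmod (poly (map_poly of_real P) (of_real (Re u) + \<zeta>)) powr p * (cmod (u - 1) powr a * cmod (u + 1) powr b)
    \<le> 2 powr p * (3 * 2 powr (a + b)) * integral {0..1} (\<lambda>x. wmod (circ_lift P) p a b ((1 + circ x / n) * u))"
proof -
  obtain \<xi> where \<xi>: "cmod \<xi> \<le> 1/2"
    "cmod (poly (map_poly of_real P) (of_real (Re u) + \<zeta>)) \<le> 2 * cmod (poly (circ_lift P) (u + u / n * \<xi>))"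
    using poly_le_circ_lift[OF u n \<zeta>] by blast
  have "cmod (poly (map_poly of_real P) (of_real (Re u) + \<zeta>)) powr p * (cmod (u - 1) powr a * cmod (u + 1) powr b)
    \<le> (2 * cmod (poly (circ_lift P) (u + u / n * \<xi>))) powr p * (cmod (u - 1) powr a * cmod (u + 1) powr b)"
    using \<xi> pos by (intro mult_right_mono powr_mono2) auto
  also have "\<dots> = 2 powr p * (cmod (poly (circ_lift P) (u + u / n * \<xi>)) powr p * cmod (u - 1) powr a * cmod (u + 1) powr b)"
    by (simp add: powr_mult)
  also have "\<dots> \<le> 2 powr p * (3 * 2 powr (a + b) * integral {0..1} (\<lambda>x. wmod (circ_lift P) p a b (u + u / n * circ x)))"
    using u n \<xi> by (intro mult_left_mono wmod_local_bound pos) auto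
  also have "(\<lambda>x. wmod (circ_lift P) p a b (u + u / n * circ x)) = (\<lambda>x. wmod (circ_lift P) p a b ((1 + circ x / n) * u))"
    by (simp add: algebra_simps)
  finally show ?thesis by simp
qed

section \<open>Finite differences and Cauchy's inequalities\<close>

lemma alternating_binomial_power_sum:
  fixes c :: "'a::comm_ring_1"
  assumes "r < k"
  shows "(\<Sum>i\<le>k. of_nat (k choose i) * (-1) ^ i * (c + of_nat i) ^ r) = 0"
  using assms
proof (induction k arbitrary: r)
  case (Suc k)
  \<comment> \<open>Pascal's rule trades one order of the alternating sum for a first difference of
    g, which lowers the degree of a power in \<open>step\<close>.\<close>
  have rec: "(\<Sum>i\<le>Suc k. of_nat (Suc k choose i) * (-1) ^ i * g i) =
     (\<Sum>i\<le>k. of_nat (k choose i) * (-1) ^ i * (g i - g (Suc i)))" for g :: "nat \<Rightarrow> 'a"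
  proof -
    have A: "(\<Sum>i\<le>k. of_nat (k choose i) * (-1) ^ i * g i) =
       g 0 + (\<Sum>i\<le>k. of_nat (k choose Suc i) * (-1) ^ Suc i * g (Suc i))"
    proof -
      have "(\<Sum>i\<le>k. of_nat (k choose i) * (-1) ^ i * g i) = (\<Sum>i\<le>Suc k. of_nat (k choose i) * (-1) ^ i * g i)"
        by (simp add: binomial_eq_0)
      also have "\<dots> = g 0 + (\<Sum>i\<le>k. of_nat (k choose Suc i) * (-1) ^ Suc i * g (Suc i))"
        by (subst sum.atMost_Suc_shift) simp
      finally show ?thesis .
    qed
    have "(\<Sum>i\<le>Suc k. of_nat (Suc k choose i) * (-1) ^ i * g i) =
      g 0 + (\<Sum>i\<le>k. of_nat (Suc k choose Suc i) * (-1) ^ Suc i * g (Suc i))"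
      by (subst sum.atMost_Suc_shift) simp
    also have "(\<Sum>i\<le>k. of_nat (Suc k choose Suc i) * (-1) ^ Suc i * g (Suc i)) =
      (\<Sum>i\<le>k. of_nat (k choose Suc i) * (-1) ^ Suc i * g (Suc i)) + (\<Sum>i\<le>k. of_nat (k choose i) * (-1) ^ Suc i * g (Suc i))"
      by (simp add: algebra_simps flip: sum.distrib)
    also have "g 0 + \<dots> = (\<Sum>i\<le>k. of_nat (k choose i) * (-1) ^ i * g i) + (\<Sum>i\<le>k. of_nat (k choose i) * (-1) ^ Suc i * g (Suc i))"
      unfolding A by simp
    finally show ?thesis by (simp add: algebra_simps flip: sum.distrib)
  qed
  have step: "(c + of_nat i) ^ r - (c + of_nat (Suc i)) ^ r = - (\<Sum>j<r. of_nat (r choose j) * (c + of_nat i) ^ j)" for i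
  proof -
    have "(c + of_nat (Suc i)) ^ r = ((c + of_nat i) + 1) ^ r" by (simp add: algebra_simps)
    also have "\<dots> = (\<Sum>j\<le>r. of_nat (r choose j) * (c + of_nat i) ^ j)"
      by (subst binomial_ring) simp
    also have "\<dots> = (\<Sum>j<r. of_nat (r choose j) * (c + of_nat i) ^ j) + (c + of_nat i) ^ r"
      by (simp add: lessThan_Suc_atMost[symmetric])
    finally show ?thesis by simp
  qed
  have "(\<Sum>i\<le>Suc k. of_nat (Suc k choose i) * (-1) ^ i * (c + of_nat i) ^ r) =
    (\<Sum>i\<le>k. of_nat (k choose i) * (-1) ^ i * (- (\<Sum>j<r. of_nat (r choose j) * (c + of_nat i) ^ j)))"
    unfolding rec step ..
  also have "\<dots> = - (\<Sum>j<r. of_nat (r choose j) * (\<Sum>i\<le>k. of_nat (k choose i) * (-1) ^ i * (c + of_nat i) ^ j))"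
    by (simp add: sum_distrib_left sum_negf mult_ac) (rule sum.swap)
  also have "\<dots> = 0" using Suc.IH Suc.prems by simp
  finally show ?case .
qed simp

text \<open>The Taylor terms of f at x of order below k are annihilated. The r-th coefficient is at
  most B / R ^ r and every node is within k \<eta> / 2 of x, so the remaining series is dominated by
  a geometric one with ratio \<rho> = k \<eta> / (2 R) \<le> 1/2. Its sum is at most 2 * 2 ^ k *
  \<rho> ^ k * B, in which the k-th powers of 2 cancel.\<close>

lemma central_difference_bound:
  fixes f :: "complex \<Rightarrow> complex"
  assumes hol: "f holomorphic_on cball x R" and R: "R > 0"
    and B: "\<And>\<zeta>. cmod \<zeta> \<le> R \<Longrightarrow> cmod (f (x + \<zeta>)) \<le> B"
    and eta: "0 \<le> \<eta>" "real k * \<eta> \<le> R"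
  shows "cmod (\<Sum>i=0..k. of_nat (k choose i) * (-1) ^ (k - i) * f (x + of_real (\<eta> * (real i - real k / 2))))
    \<le> 2 * real k ^ k * (\<eta> / R) ^ k * B"
proof -
  define c where "c r = (deriv ^^ r) f x / fact r" for r
  have B0: "B \<ge> 0" using B[of 0] R order.trans[OF norm_ge_zero] by simp
  have c: "cmod (c r) \<le> B / R ^ r" for r
  proof -
    have "cmod ((deriv ^^ r) f x) \<le> fact r * B / R ^ r"
    proof (rule Cauchy_inequality)
      show "f holomorphic_on ball x R" using hol by (rule holomorphic_on_subset) auto
      show "continuous_on (cball x R) f" using hol by (rule holomorphic_on_imp_continuous_on)
      show "cmod (f y) \<le> B" if "cmod (x - y) = R" for y
        using B[of "y - x"] that by (simp add: norm_minus_commute)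
    qed (rule R)
    then show ?thesis by (simp add: c_def norm_divide field_simps)
  qed
  define t where "t i = \<eta> * (real i - real k / 2)" for i
  have t: "\<bar>t i\<bar> \<le> real k * \<eta> / 2" if "i \<le> k" for i
  proof -
    have "\<bar>t i\<bar> = \<eta> * \<bar>real i - real k / 2\<bar>" using eta by (simp add: t_def abs_mult)
    also have "\<dots> \<le> \<eta> * (real k / 2)" using that eta by (intro mult_left_mono) (auto simp: abs_if)
    finally show ?thesis by (simp add: mult.commute)
  qed
  have sums1: "(\<lambda>r. c r * of_real (t i) ^ r) sums f (x + of_real (t i))" if "i \<le> k" for i
  proof -
    have "x + of_real (t i) \<in> ball x R" using t[OF that] eta R by (simp add: dist_norm)
    then show ?thesis unfolding c_def
      using holomorphic_power_series[OF holomorphic_on_subset[OF hol ball_subset_cball], of "x + of_real (t i)"] by simp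
  qed
  define s where "s r = (\<Sum>i=0..k. of_nat (k choose i) * (-1) ^ (k - i) * (c r * of_real (t i) ^ r))" for r
  define \<Delta> where "\<Delta> = (\<Sum>i=0..k. of_nat (k choose i) * (-1) ^ (k - i) * f (x + of_real (t i)))"
  have sums: "s sums \<Delta>" unfolding s_def \<Delta>_def by (intro sums_sum sums_mult sums1) auto
  have s0: "s r = 0" if "r < k" for r
  proof -
    have sgn: "(-1::complex) ^ (k - i) = (-1) ^ k * (-1) ^ i" if "i \<le> k" for i
    proof -
      have "(-1::complex) ^ k = (-1) ^ (k - i) * (-1) ^ i" using that by (simp flip: power_add)
      then show ?thesis by (simp add: mult.assoc flip: power_mult_distrib)
    qed
    have "s r = (\<Sum>i\<le>k. ((-1) ^ k * c r * of_real \<eta> ^ r) *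
        (of_nat (k choose i) * (-1) ^ i * (- of_real (real k / 2) + of_nat i) ^ r))"
      unfolding s_def atMost_atLeast0
      by (intro sum.cong refl) (simp add: sgn t_def power_mult_distrib[symmetric] algebra_simps)
    also have "\<dots> = 0" using alternating_binomial_power_sum[OF that, of "- complex_of_real (real k / 2)"]
      by (simp flip: sum_distrib_left)
    finally show ?thesis .
  qed
  define \<rho> where "\<rho> = real k * \<eta> / (2 * R)"
  have rho: "0 \<le> \<rho>" "\<rho> \<le> 1/2" using eta R by (auto simp: \<rho>_def field_simps)
  have sb: "cmod (s r) \<le> 2 ^ k * B * \<rho> ^ r" for r
  proof -
    have "cmod (s r) \<le> (\<Sum>i=0..k. real (k choose i) * (B * \<rho> ^ r))"
      unfolding s_def
    proof (rule sum_norm_le)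
      fix i assume i: "i \<in> {0..k}"
      have "cmod (c r) * \<bar>t i\<bar> ^ r \<le> (B / R ^ r) * (real k * \<eta> / 2) ^ r"
        using c[of r] t[of i] i B0 R by (intro mult_mono power_mono) auto
      also have "\<dots> = B * \<rho> ^ r" by (simp add: \<rho>_def power_divide power_mult_distrib)
      finally show "cmod (of_nat (k choose i) * (- 1) ^ (k - i) * (c r * complex_of_real (t i) ^ r)) \<le> real (k choose i) * (B * \<rho> ^ r)"
        by (simp add: norm_mult norm_power mult_left_mono)
    qed
    also have "\<dots> = real (\<Sum>i=0..k. k choose i) * (B * \<rho> ^ r)" by (simp add: sum_distrib_right)
    also have "(\<Sum>i=0..k. k choose i) = 2 ^ k" by (simp add: choose_row_sum flip: atMost_atLeast0)
    finally show ?thesis by simp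
  qed
  have "(\<lambda>r. s (r + k)) sums \<Delta>" using sums s0 by (simp add: sums_iff_shift)
  moreover have geo: "(\<lambda>r. 2 ^ k * B * \<rho> ^ k * \<rho> ^ r) sums (2 ^ k * B * \<rho> ^ k * (1 / (1 - \<rho>)))"
    using rho by (intro sums_mult geometric_sums) auto
  ultimately have "cmod \<Delta> \<le> 2 ^ k * B * \<rho> ^ k * (1 / (1 - \<rho>))"
  proof -
    assume 1: "(\<lambda>r. s (r + k)) sums \<Delta>"
    have "cmod (\<Sum>r. s (r + k)) \<le> (\<Sum>r. 2 ^ k * B * \<rho> ^ k * \<rho> ^ r)"
      by (rule norm_suminf_le) (use sb[of "_ + k"] sums_summable[OF geo] in \<open>simp_all add: power_add mult_ac\<close>)
    then show ?thesis by (simp only: sums_unique[OF 1, symmetric] sums_unique[OF geo, symmetric])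
  qed
  also have "\<dots> \<le> 2 ^ k * B * \<rho> ^ k * 2"
    using rho B0 by (intro mult_left_mono) (auto simp: field_simps)
  also have "\<dots> = 2 * real k ^ k * (\<eta> / R) ^ k * B"
    by (simp add: \<rho>_def power_divide power_mult_distrib)
  finally show ?thesis unfolding \<Delta>_def t_def .
qed

section \<open>The inequality for differences of polynomials\<close>

lemma poly_map_poly_of_real: "poly (map_poly complex_of_real P) (of_real x) = of_real (poly P x)"
  by (simp add: poly_altdef coeff_map_poly degree_map_poly)

lemma borel_measurable_poly [measurable]:
  fixes f :: "'a \<Rightarrow> real"
  assumes "f \<in> borel_measurable M"
  shows "(\<lambda>x. poly P (f x)) \<in> borel_measurable M"
  using assms by (rule measurable_compose) (intro borel_measurable_continuous_onI continuous_intros)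

section \<open>The change of variables x = cos (2 pi y)\<close>

lemma nn_integral_lebesgue_on_Icc:
  "(\<integral>\<^sup>+x. f x \<partial>lebesgue_on {a..b::real}) = (\<integral>\<^sup>+x. f x * indicator {a..b} x \<partial>lborel)"
  by (subst nn_integral_restrict_space) (simp_all add: nn_integral_completion)

text \<open>The lower half of the circle is used because cos (2 pi y) increases from -1 to 1 on
  [1/2, 1], as the substitution rule with a nonnegative derivative requires.\<close>

lemma nn_integral_cos_substitution:
  assumes [measurable]: "F \<in> borel_measurable borel"
  shows "(\<integral>\<^sup>+x. F x * indicator {-1..1} x \<partial>lborel) =
    (\<integral>\<^sup>+y. F (cos (2 * pi * y)) * ennreal (2 * pi * \<bar>sin (2 * pi * y)\<bar>) * indicator {1/2..1} y \<partial>lborel)"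
proof -
  have sin: "sin (2 * pi * y) \<le> 0" if "y \<in> {1/2..1}" for y :: real
    using sin_le_zero[of "2 * pi * y"] that
  proof (cases "y = 1")
    case False
    then show ?thesis using that by (intro sin_le_zero) auto
  qed simp
  have "(\<integral>\<^sup>+x. F x * indicator {cos (2 * pi * (1/2))..cos (2 * pi * 1)} x \<partial>lborel) =
    (\<integral>\<^sup>+y. F (cos (2 * pi * y)) * ennreal (- sin (2 * pi * y) * (2 * pi)) * indicator {1/2..1} y \<partial>lborel)"
    by (rule nn_integral_substitution_aux)
       (use sin in \<open>auto intro!: derivative_eq_intros continuous_intros simp: mult_nonpos_nonneg\<close>)
  also have "\<dots> = (\<integral>\<^sup>+y. F (cos (2 * pi * y)) * ennreal (2 * pi * \<bar>sin (2 * pi * y)\<bar>) * indicator {1/2..1} y \<partial>lborel)"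
    by (intro nn_integral_cong) (use sin in \<open>auto simp: indicator_def mult_ac abs_of_nonpos\<close>)
  finally show ?thesis by simp
qed

lemma nn_integral_reflect_le:
  fixes f :: "real \<Rightarrow> ennreal"
  assumes [measurable]: "f \<in> borel_measurable borel" and sym: "\<And>y. f (1 - y) = f y"
  shows "(\<integral>\<^sup>+y. f y * indicator {0..1} y \<partial>lborel) \<le> 2 * (\<integral>\<^sup>+y. f y * indicator {1/2..1} y \<partial>lborel)"
proof -
  have "(\<integral>\<^sup>+y. f y * indicator {0..1} y \<partial>lborel) \<le>
    (\<integral>\<^sup>+y. f y * indicator {0..1/2} y + f y * indicator {1/2..1} y \<partial>lborel)"
    by (intro nn_integral_mono) (auto simp: indicator_def)
  also have "\<dots> = (\<integral>\<^sup>+y. f y * indicator {0..1/2} y \<partial>lborel) + (\<integral>\<^sup>+y. f y * indicator {1/2..1} y \<partial>lborel)"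
    by (rule nn_integral_add) auto
  also have "(\<integral>\<^sup>+y. f y * indicator {0..1/2} y \<partial>lborel) = (\<integral>\<^sup>+y. f (1 - y) * indicator {0..1/2} (1 - y) \<partial>lborel)"
    by (subst nn_integral_real_affine[of _ "-1" 1]) auto
  also have "\<dots> = (\<integral>\<^sup>+y. f y * indicator {1/2..1} y \<partial>lborel)"
    by (intro nn_integral_cong) (auto simp: sym indicator_def)
  finally show ?thesis by (simp add: mult_2)
qed

lemma nn_integral_continuous_Icc:
  fixes f :: "real \<Rightarrow> real"
  assumes "continuous_on {a..b} f" "\<And>x. x \<in> {a..b} \<Longrightarrow> f x \<ge> 0"
  shows "(\<integral>\<^sup>+x. ennreal (f x) * indicator {a..b} x \<partial>lborel) = ennreal (integral {a..b} f)"
proof -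
  have int: "set_integrable lborel {a..b} f"
    by (rule borel_integrable_atLeastAtMost') (rule assms(1))
  have "(\<integral>\<^sup>+x. ennreal (f x) * indicator {a..b} x \<partial>lborel) = (\<integral>\<^sup>+x. ennreal (indicator {a..b} x *\<^sub>R f x) \<partial>lborel)"
    by (intro nn_integral_cong) (auto simp: indicator_def)
  also have "\<dots> = ennreal (LINT x:{a..b}|lborel. f x)"
    unfolding set_lebesgue_integral_def using int assms(2)
    by (intro nn_integral_eq_integral) (auto simp: set_integrable_def indicator_def)
  also have "(LINT x:{a..b}|lborel. f x) = integral {a..b} f"
    by (rule set_borel_integral_eq_integral[OF int])
  finally show ?thesis .
qed

lemma circ_Re_Im: "Re (circ y) = cos (2 * pi * y)" "Im (circ y) = sin (2 * pi * y)"
  by (simp_all add: circ_eq)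

lemma unit_circle_distances:
  assumes "cmod u = 1"
  shows "cmod (u - 1) ^ 2 = 2 * (1 - Re u)" "cmod (u + 1) ^ 2 = 2 * (1 + Re u)"
    "cmod (u - 1) * cmod (u + 1) = 2 * \<bar>Im u\<bar>"
proof -
  have 1: "(Re u)\<^sup>2 + (Im u)\<^sup>2 = 1" using assms cmod_power2[of u] by simp
  show a: "cmod (u - 1) ^ 2 = 2 * (1 - Re u)" unfolding cmod_power2 using 1 by (simp add: power2_eq_square algebra_simps)
  show b: "cmod (u + 1) ^ 2 = 2 * (1 + Re u)" unfolding cmod_power2 using 1 by (simp add: power2_eq_square algebra_simps)
  have "(cmod (u - 1) * cmod (u + 1))\<^sup>2 = (2 * \<bar>Im u\<bar>)\<^sup>2"
    unfolding power_mult_distrib a b using 1 by (simp add: power2_eq_square algebra_simps)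
  then show "cmod (u - 1) * cmod (u + 1) = 2 * \<bar>Im u\<bar>" by (rule power2_eq_imp_eq) auto
qed

text \<open>The factor |Im u| is the Jacobian of the cosine substitution; by
  \<open>unit_circle_distances\<close> it adds 1 to each exponent and 1 to the power of 1/2. At u =
  1 and u = -1 both sides vanish, since 0 powr x = 0.\<close>

lemma jacobi_weight_circle:
  assumes u: "cmod u = 1" and p: "p > 0"
  shows "\<bar>jacobi_weight \<alpha> \<beta> (Re u)\<bar> powr p * \<bar>Im u\<bar> =
    2 powr (- (\<alpha> * p + \<beta> * p + 1)) * (cmod (u - 1) powr (2 * \<alpha> * p + 1) * cmod (u + 1) powr (2 * \<beta> * p + 1))"
proof (cases "Im u = 0")
  case True
  then have "cmod (u - 1) = 0 \<or> cmod (u + 1) = 0" using unit_circle_distances(3)[OF u] by simp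
  then show ?thesis using True by auto
next
  case False
  define s t where "s = cmod (u - 1)" and "t = cmod (u + 1)"
  have st: "s * t = 2 * \<bar>Im u\<bar>" unfolding s_def t_def by (rule unit_circle_distances(3)[OF u])
  then have pos: "s > 0" "t > 0" using False by (auto simp: s_def t_def)
  have e: "1 - Re u = s powr 2 / 2" "1 + Re u = t powr 2 / 2"
    using unit_circle_distances(1,2)[OF u] pos unfolding s_def t_def by (simp_all add: powr_numeral)
  have h: "(r powr 2 / 2) powr x = r powr (2 * x) * 2 powr (- x)" for r x :: real
    by (simp add: powr_divide powr_powr powr_minus field_simps del: powr_numeral)
  have "jacobi_weight \<alpha> \<beta> (Re u) = s powr (2 * \<alpha>) * t powr (2 * \<beta>) * 2 powr (- \<alpha> - \<beta>)"
    unfolding jacobi_weight_def e h by (simp add: powr_diff powr_minus field_simps)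
  then have "\<bar>jacobi_weight \<alpha> \<beta> (Re u)\<bar> powr p = s powr (2 * \<alpha> * p) * t powr (2 * \<beta> * p) * 2 powr (- \<alpha> * p - \<beta> * p)"
    using pos by (simp add: abs_mult powr_mult powr_powr algebra_simps)
  moreover have "\<bar>Im u\<bar> = s * t / 2" using st by simp
  ultimately show ?thesis
    unfolding s_def[symmetric] t_def[symmetric] using pos
    by (simp add: powr_add powr_diff powr_minus field_simps)
qed

text \<open>The symmetry under conjugation reduces the circle to its lower half, on which the
  substitution is one-to-one. The constant is the product of this factor 2 and \<kappa> / (2 pi),
  from the weight and the Jacobian.\<close>

lemma nn_integral_wmod_circle:
  assumes p: "p > 0" and ab: "a = 2 * \<alpha> * p + 1" "b = 2 * \<beta> * p + 1" "\<alpha> \<ge> 0" "\<beta> \<ge> 0"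
  shows "ennreal (integral {0..1} (\<lambda>y. wmod (circ_lift P) p a b (circ y)))
    \<le> ennreal (2 powr (\<alpha> * p + \<beta> * p + 1) / pi) * (\<integral>\<^sup>+x. ennreal (\<bar>jacobi_weight \<alpha> \<beta> x * poly P x\<bar> powr p) \<partial>lebesgue_on {-1..1})"
proof -
  let ?v = "\<lambda>y. wmod (circ_lift P) p a b (circ y)"
  define \<kappa> where "\<kappa> = 2 powr (\<alpha> * p + \<beta> * p + 1)"
  have kappa: "\<kappa> > 0" "2 powr (- (\<alpha> * p + \<beta> * p + 1)) = 1 / \<kappa>" unfolding \<kappa>_def by (simp_all only: powr_minus_divide) auto
  have pos: "a > 0" "b > 0" using ab p by (simp_all add: add_nonneg_pos)
  have cont: "continuous_on UNIV ?v" by (intro continuous_on_wmod continuous_intros p pos)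
  then have [measurable]: "?v \<in> borel_measurable borel" by (rule borel_measurable_continuous_onI)
  have sym: "?v (1 - y) = ?v y" for y
  proof -
    have "circ (1 - y) = cnj (circ y)" by (simp add: complex_eq_iff circ_Re_Im right_diff_distrib cos_diff sin_diff)
    then show ?thesis by (simp add: wmod_circ_lift_cnj)
  qed
  have eq: "\<bar>jacobi_weight \<alpha> \<beta> (cos (2 * pi * y)) * poly P (cos (2 * pi * y))\<bar> powr p * (2 * pi * \<bar>sin (2 * pi * y)\<bar>) = 2 * pi / \<kappa> * ?v y" for y
  proof -
    have "(circ y + 1 / circ y) / 2 = of_real (cos (2 * pi * y))"
    proof -
      have "1 / circ y = cnj (circ y)" using cnj_circ_mult(1)[of y] by (simp add: field_simps)
      then show ?thesis by (simp add: complex_eq_iff circ_Re_Im)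
    qed
    then have "poly (circ_lift P) (circ y) = circ y ^ degree P * of_real (poly P (cos (2 * pi * y)))"
      by (simp add: poly_circ_lift poly_map_poly_of_real)
    then have G: "cmod (poly (circ_lift P) (circ y)) = \<bar>poly P (cos (2 * pi * y))\<bar>"
      by (simp add: norm_mult norm_power)
    have "\<bar>jacobi_weight \<alpha> \<beta> (cos (2 * pi * y))\<bar> powr p * \<bar>sin (2 * pi * y)\<bar> = 1 / \<kappa> * (cmod (circ y - 1) powr a * cmod (circ y + 1) powr b)"
      using jacobi_weight_circle[of "circ y" p \<alpha> \<beta>] p kappa by (simp add: circ_Re_Im ab)
    then show ?thesis unfolding wmod_def G by (simp add: abs_mult powr_mult mult_ac)
  qed
  have "ennreal (integral {0..1} ?v) = (\<integral>\<^sup>+y. ennreal (?v y) * indicator {0..1} y \<partial>lborel)"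
    by (rule nn_integral_continuous_Icc[symmetric]) (auto intro: continuous_on_subset[OF cont] wmod_nonneg)
  also have "\<dots> \<le> 2 * (\<integral>\<^sup>+y. ennreal (?v y) * indicator {1/2..1} y \<partial>lborel)"
    by (rule nn_integral_reflect_le) (auto simp: sym)
  also have "\<dots> = ennreal (\<kappa> / pi) * (ennreal (2 * pi / \<kappa>) * (\<integral>\<^sup>+y. ennreal (?v y) * indicator {1/2..1} y \<partial>lborel))"
    using kappa by (simp add: mult.assoc[symmetric] ennreal_mult[symmetric])
  also have "ennreal (2 * pi / \<kappa>) * (\<integral>\<^sup>+y. ennreal (?v y) * indicator {1/2..1} y \<partial>lborel)
     = (\<integral>\<^sup>+y. ennreal (2 * pi / \<kappa> * ?v y) * indicator {1/2..1} y \<partial>lborel)"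
  proof -
    have "ennreal (2 * pi / \<kappa> * ?v y) = ennreal (2 * pi / \<kappa>) * ennreal (?v y)" for y
      using kappa by (intro ennreal_mult) (auto simp: wmod_nonneg)
    then show ?thesis by (simp only: mult.assoc) (simp add: nn_integral_cmult)
  qed
  also have "\<dots> = (\<integral>\<^sup>+x. ennreal (\<bar>jacobi_weight \<alpha> \<beta> x * poly P x\<bar> powr p) * indicator {-1..1} x \<partial>lborel)"
    unfolding eq[symmetric] by (subst nn_integral_cos_substitution) (auto simp: jacobi_weight_def ennreal_mult')
  finally show ?thesis unfolding nn_integral_lebesgue_on_Icc \<kappa>_def .
qed

text \<open>The symmetric difference without the cut-off at [-1, 1]. For a polynomial it obeys the
  analytic estimate at every x, whether or not the nodes stay in the interval.\<close>

definition full_diff :: "nat \<Rightarrow> real \<Rightarrow> (real \<Rightarrow> real) \<Rightarrow> real \<Rightarrow> real" where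
  "full_diff k h f x = (\<Sum>i=0..k. real (k choose i) * (-1) ^ (k - i) * f (x - real k * h / 2 + real i * h))"

lemma sym_diff_alt:
  "sym_diff k h f x = (if {x - real k * h / 2 .. x + real k * h / 2} \<subseteq> {-1..1} then full_diff k h f x else 0)"
  by (simp add: sym_diff_def full_diff_def)

lemma phi_nonneg: "x \<in> {-1..1} \<Longrightarrow> phi x \<ge> 0"
  by (auto simp: phi_def abs_square_le_1 abs_le_iff)

lemma segment_in_Icc_iff:
  assumes "x \<in> {-1..1}" "h \<ge> 0"
  shows "{x - real k * (h * phi x) / 2 .. x + real k * (h * phi x) / 2} \<subseteq> {-1..1} \<longleftrightarrow>
    real k * h * phi x / 2 \<le> 1 - x \<and> real k * h * phi x / 2 \<le> 1 + x"
  using assms phi_nonneg[OF assms(1)] by (auto simp: mult.assoc)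

text \<open>Each base of the shifted weight is the distance from an endpoint to the nearer end of
  the segment about x. With nonnegative exponents it is thus a lower bound for the Jacobi weight on
  the whole segment, in particular at all nodes.\<close>

lemma shifted_weight_le:
  assumes "x \<in> {-1..1}" "\<bar>y - x\<bar> \<le> \<delta> * phi x / 2" "\<delta> * phi x / 2 \<le> 1 - x" "\<delta> * phi x / 2 \<le> 1 + x" "\<alpha> \<ge> 0" "\<beta> \<ge> 0"
  shows "0 \<le> shifted_weight \<alpha> \<beta> \<delta> x" "shifted_weight \<alpha> \<beta> \<delta> x \<le> jacobi_weight \<alpha> \<beta> y"
proof -
  have "1 - x - \<delta> * phi x / 2 \<le> 1 - y" "1 + x - \<delta> * phi x / 2 \<le> 1 + y" using assms(2) by linarith+
  then show "shifted_weight \<alpha> \<beta> \<delta> x \<le> jacobi_weight \<alpha> \<beta> y"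
    unfolding shifted_weight_def jacobi_weight_def using assms(3-6) by (intro mult_mono powr_mono2) auto
qed (simp add: shifted_weight_def)

text \<open>On the disc of radius R = |Im u| / (8 n) about Re u the polynomial is bounded by
  \<open>poly_disc_bound\<close>, and the step \<eta> = h |Im u| gives \<eta> / R = 8 n h. The
  assumption on k * h says that k \<eta> fits into R. For Im u = 0 the weight factor on the left is
  0.\<close>

lemma poly_full_diff_circle:
  assumes pos: "p > 0" "a > 0" "b > 0" and n: "degree P < n" and h: "0 \<le> h" "real k * h \<le> 1 / (8 * n)"
    and k: "k \<ge> 1" and u: "cmod u = 1"
  shows "\<bar>full_diff k (h * \<bar>Im u\<bar>) (poly P) (Re u)\<bar> powr p * (cmod (u - 1) powr a * cmod (u + 1) powr b)
    \<le> (2 * real k ^ k * (8 * n * h) ^ k) powr p * (2 powr p * (3 * 2 powr (a + b)) *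
      integral {0..1} (\<lambda>x. wmod (circ_lift P) p a b ((1 + circ x / n) * u)))"
proof (cases "Im u = 0")
  case True
  have "0 \<le> integral {0..1} (\<lambda>x. wmod (circ_lift P) p a b ((1 + circ x / n) * u))"
    using n by (intro integral_nonneg integrable_continuous_real continuous_on_wmod continuous_intros pos wmod_nonneg) auto
  moreover have "cmod (u - 1) = 0 \<or> cmod (u + 1) = 0" using True unit_circle_distances(3)[OF u] by simp
  then have Z: "cmod (u - 1) powr a * cmod (u + 1) powr b = 0" by auto
  ultimately show ?thesis unfolding Z by simp
next
  case False
  define A where "A = 2 powr p * (3 * 2 powr (a + b)) * integral {0..1} (\<lambda>x. wmod (circ_lift P) p a b ((1 + circ x / n) * u))"
  define W where "W = cmod (u - 1) powr a * cmod (u + 1) powr b"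
  have n1: "real n \<ge> 1" using n by simp
  have "cmod (u - 1) * cmod (u + 1) > 0" using False unit_circle_distances(3)[OF u] by simp
  then have "cmod (u - 1) > 0" "cmod (u + 1) > 0" by (auto simp: zero_less_mult_iff)
  then have W: "W > 0" unfolding W_def by simp
  \<comment> \<open>The estimate \<open>poly_disc_bound\<close> solved for |P|: one bound on the
    whole disc, expressed by the weight at the centre u alone.\<close>
  define B where "B = (A / W) powr (1 / p)"
  define \<eta> where "\<eta> = h * \<bar>Im u\<bar>"
  define R where "R = \<bar>Im u\<bar> / (8 * n)"
  let ?f = "poly (map_poly complex_of_real P)"
  have A: "A \<ge> 0"
    unfolding A_def using n
    by (intro mult_nonneg_nonneg integral_nonneg integrable_continuous_real continuous_on_wmod continuous_intros pos wmod_nonneg) auto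
  have bound: "cmod (?f (of_real (Re u) + \<zeta>)) \<le> B" if "cmod \<zeta> \<le> R" for \<zeta>
  proof -
    have "cmod (?f (of_real (Re u) + \<zeta>)) powr p * W \<le> A"
      using poly_disc_bound[OF pos u n] that unfolding W_def A_def R_def by blast
    then have "cmod (?f (of_real (Re u) + \<zeta>)) powr p \<le> A / W" using W by (simp add: field_simps)
    then have "(cmod (?f (of_real (Re u) + \<zeta>)) powr p) powr (1 / p) \<le> B"
      unfolding B_def using pos by (intro powr_mono2) auto
    then show ?thesis using pos by (simp add: powr_powr)
  qed
  have R: "R > 0" using False n1 by (simp add: R_def)
  have "complex_of_real (full_diff k \<eta> (poly P) (Re u)) =
    (\<Sum>i=0..k. of_nat (k choose i) * (-1) ^ (k - i) * ?f (of_real (Re u) + of_real (\<eta> * (real i - real k / 2))))"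
    unfolding full_diff_def of_real_sum
  proof (intro sum.cong refl)
    fix i
    have "Re u - real k * \<eta> / 2 + real i * \<eta> = Re u + \<eta> * (real i - real k / 2)" by (simp add: algebra_simps)
    then show "complex_of_real (real (k choose i) * (- 1) ^ (k - i) * poly P (Re u - real k * \<eta> / 2 + real i * \<eta>))
      = of_nat (k choose i) * (-1) ^ (k - i) * ?f (of_real (Re u) + of_real (\<eta> * (real i - real k / 2)))"
      by (simp only: of_real_add[symmetric] poly_map_poly_of_real) simp
  qed
  also have "cmod \<dots> \<le> 2 * real k ^ k * (\<eta> / R) ^ k * B"
  proof (rule central_difference_bound)
    have "real k * h * \<bar>Im u\<bar> \<le> 1 / (8 * n) * \<bar>Im u\<bar>" using h by (intro mult_right_mono) auto
    then show "real k * \<eta> \<le> R" by (simp add: \<eta>_def R_def mult_ac)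
    show "cmod (?f (of_real (Re u) + \<zeta>)) \<le> B" if "cmod \<zeta> \<le> R" for \<zeta>
      using that by (rule bound)
  qed (use h R in \<open>auto simp: \<eta>_def intro!: holomorphic_intros\<close>)
  also have "\<eta> / R = 8 * n * h" using False n1 by (simp add: \<eta>_def R_def field_simps)
  finally have "\<bar>full_diff k \<eta> (poly P) (Re u)\<bar> \<le> 2 * real k ^ k * (8 * n * h) ^ k * B" by simp
  then have "\<bar>full_diff k \<eta> (poly P) (Re u)\<bar> powr p \<le> (2 * real k ^ k * (8 * n * h) ^ k * B) powr p"
    using pos by (intro powr_mono2) auto
  also have "\<dots> = (2 * real k ^ k * (8 * n * h) ^ k) powr p * (A / W)"
    using h pos A W by (simp add: powr_mult B_def powr_powr)
  finally have "\<bar>full_diff k \<eta> (poly P) (Re u)\<bar> powr p * W \<le> (2 * real k ^ k * (8 * n * h) ^ k) powr p * A"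
    using W by (simp add: field_simps)
  then show ?thesis unfolding W_def A_def \<eta>_def by simp
qed

text \<open>The pointwise bound \<open>A y\<close> is a mean of v over a small circle about
  \<open>circ y\<close>. Integrated over y, it becomes an average over x of means of v over circles
  about 0 of radius at most 1 + 1/n, each controlled by the mean over the unit circle and hence by
  the weighted norm of P.\<close>

lemma bernstein_difference:
  assumes k: "k \<ge> 1" and p: "0 < p" and \<alpha>\<beta>: "\<alpha> \<ge> 0" "\<beta> \<ge> 0"
  shows "\<exists>C>0. \<forall>P n h. degree P < n \<longrightarrow> 0 \<le> h \<longrightarrow> real k * h \<le> 1 / (8 * real n) \<longrightarrow>
    (\<integral>\<^sup>+x. ennreal (\<bar>jacobi_weight \<alpha> \<beta> x * full_diff k (h * phi x) (poly P) x\<bar> powr p) \<partial>lebesgue_on {-1..1})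
    \<le> ennreal (C * (real n * h) powr (real k * p)) *
      (\<integral>\<^sup>+x. ennreal (\<bar>jacobi_weight \<alpha> \<beta> x * poly P x\<bar> powr p) \<partial>lebesgue_on {-1..1})"
proof -
  define a b where "a = 2 * \<alpha> * p + 1" and "b = 2 * \<beta> * p + 1"
  have pos: "p > 0" "a > 0" "b > 0" using p \<alpha>\<beta> by (simp_all add: a_def b_def add_nonneg_pos)
  define \<kappa> where "\<kappa> = 2 powr (\<alpha> * p + \<beta> * p + 1)"
  have kappa: "\<kappa> > 0" "2 powr (- (\<alpha> * p + \<beta> * p + 1)) = 1 / \<kappa>" unfolding \<kappa>_def by (simp_all only: powr_minus_divide) auto
  define C1 where "C1 = 2 powr p * (3 * 2 powr (a + b))"
  define C2 where "C2 = exp (2 * p + a + b)"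
  define C where "C = (2 * real k ^ k * 8 ^ k) powr p * (2 * C1 * C2)"
  have C: "C > 0" using k by (simp add: C_def C1_def C2_def)
  show ?thesis
  proof (intro exI conjI allI impI)
    show "C > 0" by (rule C)
    fix P :: "real poly" and n :: nat and h :: real
    assume n: "degree P < n" and h: "0 \<le> h" "real k * h \<le> 1 / (8 * real n)"
    have n1: "real n \<ge> 1" using n by simp
    let ?v = "wmod (circ_lift P) p a b"
    define Q where "Q = (2 * real k ^ k * (8 * n * h) ^ k) powr p"
    define A where "A y = integral {0..1} (\<lambda>x. ?v ((1 + circ x / n) * circ y))" for y
    have contv: "continuous_on S (\<lambda>x. ?v ((1 + circ (f x) / n) * circ (g x)))"
      if "continuous_on S f" "continuous_on S g" for S :: "'x::t2_space set" and f g
      using n by (intro continuous_on_wmod continuous_intros pos that) auto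
    have contA: "continuous_on UNIV A"
    proof -
      have "continuous_on UNIV (\<lambda>y. integral (cbox 0 1) (\<lambda>x. ?v ((1 + circ x / n) * circ y)))"
        by (rule integral_continuous_on_param) (auto simp: case_prod_unfold intro!: contv continuous_intros)
      then show ?thesis by (simp add: A_def)
    qed
    then have [measurable]: "A \<in> borel_measurable borel" by (rule borel_measurable_continuous_onI)
    have A0: "A y \<ge> 0" for y unfolding A_def
      by (intro integral_nonneg integrable_continuous_real contv continuous_intros wmod_nonneg)
    have intA: "integral {0..1} A \<le> C2 * integral {0..1} (\<lambda>y. ?v (circ y))"
    proof -
      have "integral {0..1} A = integral {0..1} (\<lambda>x. integral {0..1} (\<lambda>y. ?v ((1 + circ x / n) * circ y)))"
        unfolding A_def using integral_swap_continuous[of 0 0 1 1 "\<lambda>y x. ?v ((1 + circ x / n) * circ y)"]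
        by (simp add: case_prod_unfold contv continuous_intros)
      also have "\<dots> \<le> integral {0..1} (\<lambda>x::real. C2 * integral {0..1} (\<lambda>y. ?v (circ y)))"
      proof (rule integral_le)
        have "continuous_on {0..1} (\<lambda>x. integral (cbox 0 1) (\<lambda>y. ?v ((1 + circ x / n) * circ y)))"
          by (rule integral_continuous_on_param) (auto simp: case_prod_unfold intro!: contv continuous_intros)
        then show "(\<lambda>x. integral {0..1} (\<lambda>y. ?v ((1 + circ x / n) * circ y))) integrable_on {0..1}"
          by (intro integrable_continuous_real) simp
        show "integral {0..1} (\<lambda>y. ?v ((1 + circ x / n) * circ y)) \<le> C2 * integral {0..1} (\<lambda>y. ?v (circ y))" for x
          unfolding C2_def
        proof (rule mean_wmod_le[OF pos n])
          show "cmod (1 + circ x / n) \<le> 1 + 1 / n"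
            using norm_triangle_ineq[of 1 "circ x / n"] by (simp add: norm_divide)
        qed
      qed auto
      finally show ?thesis by simp
    qed
    have pointwise: "\<bar>jacobi_weight \<alpha> \<beta> (cos (2 * pi * y)) * full_diff k (h * phi (cos (2 * pi * y))) (poly P) (cos (2 * pi * y))\<bar> powr p
        * (2 * pi * \<bar>sin (2 * pi * y)\<bar>) \<le> 2 * pi / \<kappa> * Q * C1 * A y" for y
    proof -
      define u where "u = circ y"
      have u: "cmod u = 1" "cos (2 * pi * y) = Re u" "sin (2 * pi * y) = Im u" by (simp_all add: u_def circ_Re_Im)
      have phi: "phi (Re u) = \<bar>Im u\<bar>"
      proof -
        have "1 - (Re u)\<^sup>2 = (Im u)\<^sup>2" using u(1) cmod_power2[of u] by simp
        then show ?thesis by (simp add: phi_def)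
      qed
      have "\<bar>full_diff k (h * \<bar>Im u\<bar>) (poly P) (Re u)\<bar> powr p * (\<bar>jacobi_weight \<alpha> \<beta> (Re u)\<bar> powr p * \<bar>Im u\<bar>)
        = 1 / \<kappa> * (\<bar>full_diff k (h * \<bar>Im u\<bar>) (poly P) (Re u)\<bar> powr p * (cmod (u - 1) powr a * cmod (u + 1) powr b))"
        using jacobi_weight_circle[OF u(1) p, of \<alpha> \<beta>] kappa by (simp add: a_def b_def)
      also have "\<dots> \<le> 1 / \<kappa> * (Q * (C1 * A y))"
        using poly_full_diff_circle[OF pos n h k u(1)] kappa
        unfolding Q_def C1_def A_def u_def by (intro mult_left_mono) auto
      finally have "2 * pi * (\<bar>full_diff k (h * \<bar>Im u\<bar>) (poly P) (Re u)\<bar> powr p * (\<bar>jacobi_weight \<alpha> \<beta> (Re u)\<bar> powr p * \<bar>Im u\<bar>))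
        \<le> 2 * pi * (1 / \<kappa> * (Q * (C1 * A y)))" by (rule mult_left_mono) simp
      then show ?thesis unfolding u phi by (simp add: abs_mult powr_mult mult_ac)
    qed
    define D where "D = 2 * pi / \<kappa> * Q * C1"
    have D: "D \<ge> 0" using kappa by (simp add: D_def Q_def C1_def)
    define N where "N = (\<integral>\<^sup>+x. ennreal (\<bar>jacobi_weight \<alpha> \<beta> x * poly P x\<bar> powr p) \<partial>lebesgue_on {-1..1})"
    have "(\<integral>\<^sup>+x. ennreal (\<bar>jacobi_weight \<alpha> \<beta> x * full_diff k (h * phi x) (poly P) x\<bar> powr p) \<partial>lebesgue_on {-1..1})
      = (\<integral>\<^sup>+y. ennreal (\<bar>jacobi_weight \<alpha> \<beta> (cos (2 * pi * y)) * full_diff k (h * phi (cos (2 * pi * y))) (poly P) (cos (2 * pi * y))\<bar> powr p)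
        * ennreal (2 * pi * \<bar>sin (2 * pi * y)\<bar>) * indicator {1/2..1} y \<partial>lborel)"
      unfolding nn_integral_lebesgue_on_Icc
      by (rule nn_integral_cos_substitution) (simp add: jacobi_weight_def full_diff_def phi_def)
    \<comment> \<open>The half circle is enlarged to the full one, because the comparison of means
      holds for whole circles only.\<close>
    also have "\<dots> \<le> (\<integral>\<^sup>+y. ennreal D * (ennreal (A y) * indicator {0..1} y) \<partial>lborel)"
    proof (intro nn_integral_mono)
      fix y :: real
      have "ennreal (\<bar>jacobi_weight \<alpha> \<beta> (cos (2 * pi * y)) * full_diff k (h * phi (cos (2 * pi * y))) (poly P) (cos (2 * pi * y))\<bar> powr p)
        * ennreal (2 * pi * \<bar>sin (2 * pi * y)\<bar>) \<le> ennreal (D * A y)"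
        using pointwise[of y] unfolding D_def by (subst ennreal_mult[symmetric]) (auto intro: ennreal_leI)
      also have "\<dots> = ennreal D * ennreal (A y)" using D A0 by (rule ennreal_mult)
      finally show "ennreal (\<bar>jacobi_weight \<alpha> \<beta> (cos (2 * pi * y)) * full_diff k (h * phi (cos (2 * pi * y))) (poly P) (cos (2 * pi * y))\<bar> powr p)
        * ennreal (2 * pi * \<bar>sin (2 * pi * y)\<bar>) * indicator {1/2..1} y \<le> ennreal D * (ennreal (A y) * indicator {0..1} y)"
        by (auto simp: indicator_def)
    qed
    also have "\<dots> = ennreal D * ennreal (integral {0..1} A)"
      by (subst nn_integral_cmult) (auto intro!: arg_cong[where f="(*) (ennreal D)"] nn_integral_continuous_Icc A0 continuous_on_subset[OF contA])
    also have "\<dots> \<le> ennreal D * ennreal (C2 * integral {0..1} (\<lambda>y. ?v (circ y)))"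
      by (intro mult_left_mono ennreal_leI intA) auto
    also have "\<dots> = ennreal (D * C2) * ennreal (integral {0..1} (\<lambda>y. ?v (circ y)))"
      using D by (simp add: ennreal_mult' C2_def mult.assoc)
    also have "\<dots> \<le> ennreal (D * C2) * (ennreal (\<kappa> / pi) * N)"
      unfolding \<kappa>_def N_def by (intro mult_left_mono nn_integral_wmod_circle p a_def b_def \<alpha>\<beta>) auto
    also have "\<dots> = ennreal (D * C2 * (\<kappa> / pi)) * N"
    proof -
      have "ennreal (D * C2 * (\<kappa> / pi)) = ennreal (D * C2) * ennreal (\<kappa> / pi)"
        using kappa D by (intro ennreal_mult) (simp_all add: C2_def)
      then show ?thesis by (metis mult.assoc)
    qed
    also have "D * C2 * (\<kappa> / pi) = C * (real n * h) powr (real k * p)"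
    proof -
      have "Q = (2 * real k ^ k * 8 ^ k) powr p * ((real n * h) ^ k) powr p"
        unfolding Q_def using h by (simp add: powr_mult[symmetric] power_mult_distrib mult_ac)
      also have "((real n * h) ^ k) powr p = (real n * h) powr (real k * p)"
      proof (cases "h = 0")
        case False
        then have "real n * h > 0" using h n1 by simp
        then show ?thesis by (simp add: powr_powr flip: powr_realpow)
      qed (use k in \<open>simp add: power_0_left\<close>)
      finally show ?thesis using kappa by (simp add: D_def C_def)
    qed
    finally show "(\<integral>\<^sup>+x. ennreal (\<bar>jacobi_weight \<alpha> \<beta> x * full_diff k (h * phi x) (poly P) x\<bar> powr p) \<partial>lebesgue_on {-1..1})
      \<le> ennreal (C * (real n * h) powr (real k * p)) *
      (\<integral>\<^sup>+x. ennreal (\<bar>jacobi_weight \<alpha> \<beta> x * poly P x\<bar> powr p) \<partial>lebesgue_on {-1..1})"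
      unfolding N_def .
  qed
qed

section \<open>Boundedness of the weighted difference operator\<close>

text \<open>Since 1 \<le> 2 g', the Jacobian can be inserted at the cost of a factor 2, and the
  substitution is then exact.\<close>

lemma nn_integral_stretch_le:
  fixes F :: "real \<Rightarrow> ennreal"
  assumes [measurable]: "F \<in> borel_measurable borel" and ab: "a < b"
    and der: "\<And>x. x \<in> {a..b} \<Longrightarrow> (g has_real_derivative g' x) (at x)" and cont: "continuous_on {a..b} g'"
    and ge: "\<And>x. x \<in> {a..b} \<Longrightarrow> g' x \<ge> 1/2"
  shows "(\<integral>\<^sup>+x. F (g x) * indicator {a..b} x \<partial>lborel) \<le> 2 * (\<integral>\<^sup>+x. F x * indicator {g a..g b} x \<partial>lborel)"
proof -
  have contg: "continuous_on {a..b} g"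
    using der by (meson DERIV_isCont continuous_at_imp_continuous_on)
  have [measurable]: "(\<lambda>x. F (g x) * ennreal (g' x) * indicator {a..b} x) \<in> borel_measurable borel"
  proof -
    \<comment> \<open>Nothing is assumed about g and g' outside the interval; extension by 0 makes
      them globally measurable.\<close>
    have "(\<lambda>x. if x \<in> {a..b} then g x else 0) \<in> borel_measurable borel"
      "(\<lambda>x. if x \<in> {a..b} then g' x else 0) \<in> borel_measurable borel"
      using borel_measurable_continuous_on_if[OF _ contg continuous_on_const]
        borel_measurable_continuous_on_if[OF _ cont continuous_on_const] by auto
    then have "(\<lambda>x. F (if x \<in> {a..b} then g x else 0) * ennreal (if x \<in> {a..b} then g' x else 0) * indicator {a..b} x) \<in> borel_measurable borel"
      by measurable
    moreover have "(\<lambda>x. F (if x \<in> {a..b} then g x else 0) * ennreal (if x \<in> {a..b} then g' x else 0) * indicator {a..b} x)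
      = (\<lambda>x. F (g x) * ennreal (g' x) * indicator {a..b} x)" by (auto simp: indicator_def)
    ultimately show ?thesis by simp
  qed
  have "(\<integral>\<^sup>+x. F (g x) * indicator {a..b} x \<partial>lborel) \<le> (\<integral>\<^sup>+x. 2 * (F (g x) * ennreal (g' x) * indicator {a..b} x) \<partial>lborel)"
  proof (rule nn_integral_mono)
    fix x
    show "F (g x) * indicator {a..b} x \<le> 2 * (F (g x) * ennreal (g' x) * indicator {a..b} x)"
    proof (cases "x \<in> {a..b}")
      case True
      have "1 \<le> ennreal (2 * g' x)" using ge[OF True] by simp
      then have "F (g x) * 1 \<le> F (g x) * ennreal (2 * g' x)" by (intro mult_left_mono) auto
      then show ?thesis using True ge[OF True] by (simp add: ennreal_mult mult_ac)
    qed simp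
  qed
  also have "\<dots> = 2 * (\<integral>\<^sup>+x. F (g x) * ennreal (g' x) * indicator {a..b} x \<partial>lborel)"
    by (rule nn_integral_cmult) simp
  also have "(\<integral>\<^sup>+x. F (g x) * ennreal (g' x) * indicator {a..b} x \<partial>lborel) = (\<integral>\<^sup>+x. F x * indicator {g a..g b} x \<partial>lborel)"
  proof (rule nn_integral_substitution_aux[symmetric])
    show "0 \<le> g' x" if "x \<in> {a..b}" for x using ge[OF that] by linarith
  qed (use der cont ab in auto)
  finally show ?thesis .
qed

text \<open>Dividing q * phi x \<le> 1 - x by sqrt (1 - x) leaves q * sqrt (1 + x) \<le> sqrt (1 -
  x), which is linear in x after squaring; the other condition is its mirror image. The admissible
  centres therefore fill a compact interval inside (-1, 1), away from the singularities of the
  derivative of phi.\<close>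

lemma segment_condition_iff:
  assumes "0 < q" "-1 < x" "x < 1"
  shows "q * phi x \<le> 1 - x \<and> q * phi x \<le> 1 + x \<longleftrightarrow> \<bar>x\<bar> \<le> (1 - q\<^sup>2) / (1 + q\<^sup>2)"
proof -
  have phi: "phi x = sqrt (1 - x) * sqrt (1 + x)"
    by (simp add: phi_def algebra_simps power2_eq_square flip: real_sqrt_mult)
  have *: "q * (sqrt (1 - y) * sqrt (1 + y)) \<le> 1 - y \<longleftrightarrow> y \<le> (1 - q\<^sup>2) / (1 + q\<^sup>2)" if "-1 < y" "y < 1" for y
  proof -
    have "q * (sqrt (1 - y) * sqrt (1 + y)) \<le> 1 - y \<longleftrightarrow> sqrt (1 - y) * (q * sqrt (1 + y)) \<le> sqrt (1 - y) * sqrt (1 - y)"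
      using that by (simp add: mult_ac)
    also have "\<dots> \<longleftrightarrow> q * sqrt (1 + y) \<le> sqrt (1 - y)"
      by (rule mult_le_cancel_left_pos) (use that in simp)
    also have "\<dots> \<longleftrightarrow> sqrt (q\<^sup>2 * (1 + y)) \<le> sqrt (1 - y)" using assms(1) by (simp add: real_sqrt_mult)
    also have "\<dots> \<longleftrightarrow> q\<^sup>2 * (1 + y) \<le> 1 - y" by simp
    also have "\<dots> \<longleftrightarrow> y * (1 + q\<^sup>2) \<le> 1 - q\<^sup>2" by (simp add: algebra_simps)
    also have "\<dots> \<longleftrightarrow> y \<le> (1 - q\<^sup>2) / (1 + q\<^sup>2)"
      by (simp add: pos_le_divide_eq add_pos_nonneg)
    finally show ?thesis .
  qed
  show ?thesis using *[of x] *[of "-x"] assms unfolding phi by (auto simp: mult.commute abs_le_iff)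
qed

lemma node_derivative:
  assumes "-1 < x" "x < 1"
  shows "((\<lambda>x. x + c * phi x) has_real_derivative 1 - c * x / phi x) (at x)"
proof -
  have "x\<^sup>2 < 1" using assms by (simp add: abs_square_less_1 abs_less_iff)
  then show ?thesis unfolding phi_def
    by (auto intro!: derivative_eq_intros simp: field_simps)
qed

text \<open>Multiplying q * phi x \<le> 1 - |x| by 1 + |x| and using (phi x)^2 = (1 - |x|) (1 + |x|)
  gives q * (1 + |x|) \<le> phi x. Then 2 |x| \<le> 1 + |x| yields c * x \<le> phi x / 2. So each
  node map expands by at least 1/2 exactly where its segment is admissible.\<close>

lemma node_derivative_ge_half:
  assumes "-1 < x" "x < 1" "\<bar>c\<bar> \<le> q" "q * phi x \<le> 1 - x" "q * phi x \<le> 1 + x"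
  shows "1/2 \<le> 1 - c * x / phi x"
proof -
  have phi: "phi x > 0" "(phi x)\<^sup>2 = (1 - x) * (1 + x)"
  proof -
    have "x\<^sup>2 < 1" using assms(1,2) by (simp add: abs_square_less_1 abs_less_iff)
    then show "phi x > 0" "(phi x)\<^sup>2 = (1 - x) * (1 + x)"
      by (simp_all add: phi_def) (simp add: algebra_simps power2_eq_square)
  qed
  have "q * phi x * (1 + \<bar>x\<bar>) \<le> (1 - \<bar>x\<bar>) * (1 + \<bar>x\<bar>)"
    using assms by (intro mult_right_mono) (auto simp: abs_if)
  also have "\<dots> = (phi x)\<^sup>2" unfolding phi(2) by (auto simp: abs_if algebra_simps)
  finally have "q * (1 + \<bar>x\<bar>) \<le> phi x" using phi(1) by (simp add: power2_eq_square mult_ac)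
  moreover have "2 * \<bar>x\<bar> * q \<le> (1 + \<bar>x\<bar>) * q" using assms by (intro mult_right_mono) auto
  moreover have "c * x \<le> \<bar>x\<bar> * q"
  proof -
    have "c * x \<le> \<bar>c\<bar> * \<bar>x\<bar>" by (metis abs_ge_self abs_mult)
    also have "\<dots> \<le> q * \<bar>x\<bar>" using assms by (intro mult_right_mono) auto
    finally show ?thesis by (simp add: mult.commute)
  qed
  ultimately have "2 * (c * x) \<le> phi x" by (simp add: mult_ac)
  then show ?thesis using phi by (simp add: field_simps)
qed

text \<open>After scaling to s + t = 1 this is r \<le> r powr p on [0, 1].\<close>

lemma powr_add_le:
  fixes s t :: real
  assumes "0 \<le> s" "0 \<le> t" "p \<le> 1"
  shows "(s + t) powr p \<le> s powr p + t powr p"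
proof (cases "s + t = 0")
  case False
  then have pos: "s + t > 0" using assms by simp
  have *: "r / (s + t) \<le> (r / (s + t)) powr p" if "0 \<le> r" "r \<le> s + t" for r
  proof (cases "r = 0")
    case False
    then have "(r / (s + t)) powr 1 \<le> (r / (s + t)) powr p"
      using that pos assms by (intro powr_mono') auto
    then show ?thesis using that pos by simp
  qed simp
  have "1 = s / (s + t) + t / (s + t)" using pos by (simp flip: add_divide_distrib)
  also have "\<dots> \<le> (s / (s + t)) powr p + (t / (s + t)) powr p"
    using assms by (intro add_mono *) auto
  also have "\<dots> = (s powr p + t powr p) / (s + t) powr p"
    using assms pos by (simp add: powr_divide add_divide_distrib)
  finally show ?thesis using pos by (simp add: field_simps)
qed (use assms in auto)

lemma powr_sum_le:
  fixes f :: "'a \<Rightarrow> real"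
  assumes "finite I" "0 < p" "p \<le> 1"
  shows "\<bar>\<Sum>i\<in>I. f i\<bar> powr p \<le> (\<Sum>i\<in>I. \<bar>f i\<bar> powr p)"
  using assms(1)
proof (induction rule: finite_induct)
  case (insert i I)
  have "\<bar>f i + (\<Sum>i\<in>I. f i)\<bar> powr p \<le> (\<bar>f i\<bar> + \<bar>\<Sum>i\<in>I. f i\<bar>) powr p"
    using assms by (intro powr_mono2) auto
  also have "\<dots> \<le> \<bar>f i\<bar> powr p + \<bar>\<Sum>i\<in>I. f i\<bar> powr p"
    using assms by (intro powr_add_le) auto
  finally show ?case using insert by simp
qed simp

lemma borel_measurable_phi [measurable]: "phi \<in> borel_measurable borel"
  unfolding phi_def by measurable

lemma borel_measurable_jacobi_weight [measurable]: "jacobi_weight \<alpha> \<beta> \<in> borel_measurable borel"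
  unfolding jacobi_weight_def by measurable

text \<open>The factor 2 is the cost of changing variables at one node; the sum comes from applying
  p-subadditivity to the k + 1 terms of the difference.\<close>

definition diff_const :: "nat \<Rightarrow> real \<Rightarrow> real" where
  "diff_const k p = 2 * (\<Sum>i=0..k. real (k choose i) powr p)"

text \<open>At each node the shifted weight is at most the Jacobi weight there, and the node maps
  distort integrals by a factor of at most 2. As f is merely Lebesgue measurable, its compositions
  with the node maps are not obviously measurable; an almost everywhere Borel majorant
  \<open>H\<close> avoids the question, since monotonicity of the integral does not ask for
  measurability of the smaller function.\<close>

lemma weighted_difference_bounded:
  assumes k: "k \<ge> 1" and p: "0 < p" "p \<le> 1" and \<alpha>\<beta>: "\<alpha> \<ge> 0" "\<beta> \<ge> 0"
    and h: "0 < h" "real k * h \<le> 1" and f: "f \<in> borel_measurable (lebesgue_on {-1..1})"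
  shows "\<exists>H\<in>borel_measurable borel.
    (AE x in lborel. x \<in> {-1..1} \<longrightarrow>
      ennreal (\<bar>shifted_weight \<alpha> \<beta> (real k * h) x * sym_diff k (h * phi x) f x\<bar> powr p) \<le> H x) \<and>
    (\<integral>\<^sup>+x. H x \<partial>lborel) \<le> ennreal (diff_const k p) *
      (\<integral>\<^sup>+x. ennreal (\<bar>jacobi_weight \<alpha> \<beta> x * f x\<bar> powr p) \<partial>lebesgue_on {-1..1})"
proof -
  define q where "q = real k * h / 2"
  have q: "0 < q" "q < 1" using k h by (auto simp: q_def)
  define x0 where "x0 = (1 - q\<^sup>2) / (1 + q\<^sup>2)"
  have q2: "0 < q\<^sup>2" "q\<^sup>2 < 1" using q by (auto simp: abs_square_less_1)
  have x0: "0 < x0" "x0 < 1" using q2 by (simp_all add: x0_def add_pos_pos)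
  define c where "c i = h * (real i - real k / 2)" for i
  have c: "\<bar>c i\<bar> \<le> q" if "i \<le> k" for i
  proof -
    have "\<bar>c i\<bar> = h * \<bar>real i - real k / 2\<bar>" using h by (simp add: c_def abs_mult)
    also have "\<dots> \<le> h * (real k / 2)" using that h by (intro mult_left_mono) (auto simp: abs_if)
    finally show ?thesis by (simp add: q_def mult.commute)
  qed
  define y where "y i x = x + c i * phi x" for i x
  have y_meas [measurable]: "y i \<in> borel_measurable borel" for i unfolding y_def by measurable
  \<comment> \<open>Extension by 0 allows f to be replaced by a Borel function \<open>g\<close>,
    which can be composed with the node maps; \<open>N\<close> is a Borel null set containing the
    points where they differ.\<close>
  define fR where "fR x = (if x \<in> {-1..1} then f x else 0)" for x
  have "fR \<in> borel_measurable (completion lborel)"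
  proof -
    have "fR = (\<lambda>x. indicator {-1..1} x *\<^sub>R f x)" by (auto simp: fR_def indicator_def)
    moreover have "(\<lambda>x. indicator {-1..1} x *\<^sub>R f x) \<in> borel_measurable lebesgue"
      using f by (subst borel_measurable_restrict_space_iff[symmetric]) auto
    ultimately show ?thesis by simp
  qed
  then obtain g where g [measurable]: "g \<in> borel_measurable borel" and ae_g: "AE x in lborel. fR x = g x"
    using completion_ex_borel_measurable_real[of fR lborel] by auto
  obtain N where N: "{x. fR x \<noteq> g x} \<subseteq> N" "N \<in> sets borel" "emeasure lborel N = 0"
    using ae_g by (auto elim!: AE_E)
  define F where "F x = ennreal (\<bar>jacobi_weight \<alpha> \<beta> x * g x\<bar> powr p) * indicator {-1..1} x" for x
  have F [measurable]: "F \<in> borel_measurable borel" unfolding F_def by measurable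
  have stretch: "(\<integral>\<^sup>+x. G (y i x) * indicator {-x0..x0} x \<partial>lborel) \<le> 2 * (\<integral>\<^sup>+x. G x \<partial>lborel)"
    if [measurable]: "G \<in> borel_measurable borel" and i: "i \<le> k" for G :: "real \<Rightarrow> ennreal" and i
  proof -
    have "(\<integral>\<^sup>+x. G (y i x) * indicator {-x0..x0} x \<partial>lborel) \<le> 2 * (\<integral>\<^sup>+x. G x * indicator {y i (-x0)..y i x0} x \<partial>lborel)"
    proof (rule nn_integral_stretch_le)
      fix x assume x: "x \<in> {-x0..x0}"
      then have x1: "-1 < x" "x < 1" using x0 by auto
      show "(y i has_real_derivative 1 - c i * x / phi x) (at x)"
        unfolding y_def using x1 by (rule node_derivative)
      have "\<bar>x\<bar> \<le> x0" using x by auto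
      then have "q * phi x \<le> 1 - x" "q * phi x \<le> 1 + x"
        using segment_condition_iff[OF q(1) x1] unfolding x0_def by auto
      then show "1 / 2 \<le> 1 - c i * x / phi x" using c[OF i] x1 by (intro node_derivative_ge_half) auto
    next
      have "phi x \<noteq> 0" if "x \<in> {-x0..x0}" for x
      proof -
        have "-1 < x" "x < 1" using that x0 by auto
        then have "x\<^sup>2 < 1" by (simp add: abs_square_less_1 abs_less_iff)
        then show ?thesis by (simp add: phi_def)
      qed
      then show "continuous_on {-x0..x0} (\<lambda>x. 1 - c i * x / phi x)"
        unfolding phi_def by (intro continuous_intros) auto
    qed (use x0 in auto)
    also have "(\<integral>\<^sup>+x. G x * indicator {y i (-x0)..y i x0} x \<partial>lborel) \<le> (\<integral>\<^sup>+x. G x \<partial>lborel)"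
      by (intro nn_integral_mono) (auto simp: indicator_def)
    finally show ?thesis by (simp add: mult_left_mono)
  qed
  \<comment> \<open>The exceptional null set must stay null when pulled back along a node map. This
    is \<open>stretch\<close> applied to the indicator of \<open>N\<close>.\<close>
  have good: "AE x in lborel. x \<in> {-x0..x0} \<longrightarrow> y i x \<notin> N" if i: "i \<le> k" for i
  proof -
    have [measurable]: "N \<in> sets borel" by (rule N)
    have "(\<integral>\<^sup>+x. indicator N (y i x) * indicator {-x0..x0} x \<partial>lborel) \<le> 2 * (\<integral>\<^sup>+x. indicator N x \<partial>lborel)"
      by (rule stretch[OF _ i]) simp
    also have "\<dots> = 0" using N by simp
    finally have "(\<integral>\<^sup>+x. indicator N (y i x) * indicator {-x0..x0} x \<partial>lborel) = 0" by simp
    then have "AE x in lborel. (indicator N (y i x) * indicator {-x0..x0} x :: ennreal) = 0"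
      by (subst (asm) nn_integral_0_iff_AE) measurable
    then show ?thesis by eventually_elim (auto simp: indicator_def)
  qed
  have good': "AE x in lborel. \<forall>i\<in>{0..k}. x \<in> {-x0..x0} \<longrightarrow> y i x \<notin> N"
    using good by (intro AE_finite_allI) auto
  define H where "H x = (\<Sum>i=0..k. ennreal (real (k choose i) powr p) * (F (y i x) * indicator {-x0..x0} x))" for x
  have H [measurable]: "H \<in> borel_measurable borel" unfolding H_def by measurable
  have ae: "AE x in lborel. x \<in> {-1..1} \<longrightarrow>
      ennreal (\<bar>shifted_weight \<alpha> \<beta> (real k * h) x * sym_diff k (h * phi x) f x\<bar> powr p) \<le> H x"
    \<comment> \<open>At x = 1 and x = -1 phi vanishes and the segment degenerates to an admissible
      point outside [-x0, x0]. These two points are discarded as null.\<close>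
    using good' AE_lborel_singleton[of "1::real"] AE_lborel_singleton[of "-1::real"]
  proof eventually_elim
    case (elim x)
    show ?case
    proof
      assume x: "x \<in> {-1..1}"
      then have x1: "-1 < x" "x < 1" using elim by auto
      show "ennreal (\<bar>shifted_weight \<alpha> \<beta> (real k * h) x * sym_diff k (h * phi x) f x\<bar> powr p) \<le> H x"
      proof (cases "{x - real k * (h * phi x) / 2 .. x + real k * (h * phi x) / 2} \<subseteq> {-1..1}")
        case True
        then have seg: "q * phi x \<le> 1 - x" "q * phi x \<le> 1 + x"
          using segment_in_Icc_iff[OF x, of h k] h by (auto simp: q_def)
        then have x_in: "x \<in> {-x0..x0}" using segment_condition_iff[OF q(1) x1] by (auto simp: x0_def abs_le_iff)
        have near: "\<bar>y i x - x\<bar> \<le> q * phi x" if "i \<le> k" for i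
          using c[OF that] phi_nonneg[OF x] by (simp add: y_def abs_mult mult_right_mono)
        have y_in: "y i x \<in> {-1..1}" if "i \<le> k" for i using near[OF that] seg by auto
        have fg: "f (y i x) = g (y i x)" if "i \<le> k" for i
        proof -
          have "fR (y i x) = g (y i x)" using elim(1) that x_in N(1) by auto
          then show ?thesis using y_in[OF that] by (simp only: fR_def if_True)
        qed
        have W: "0 \<le> shifted_weight \<alpha> \<beta> (real k * h) x"
            "shifted_weight \<alpha> \<beta> (real k * h) x \<le> jacobi_weight \<alpha> \<beta> (y i x)" if "i \<le> k" for i
          using shifted_weight_le[OF x, of "y i x" "real k * h" \<alpha> \<beta>] near[OF that] seg \<alpha>\<beta> by (auto simp: q_def)
        have "\<bar>shifted_weight \<alpha> \<beta> (real k * h) x * sym_diff k (h * phi x) f x\<bar> powr p =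
          \<bar>\<Sum>i=0..k. real (k choose i) * (-1) ^ (k - i) * (shifted_weight \<alpha> \<beta> (real k * h) x * f (y i x))\<bar> powr p"
        proof -
          have "x - real k * (h * phi x) / 2 + real i * (h * phi x) = y i x" for i
            by (simp add: y_def c_def algebra_simps)
          then have "sym_diff k (h * phi x) f x = (\<Sum>i=0..k. real (k choose i) * (-1) ^ (k - i) * f (y i x))"
            using True by (simp add: sym_diff_def)
          then show ?thesis by (simp add: sum_distrib_left mult_ac)
        qed
        also have "\<dots> \<le> (\<Sum>i=0..k. \<bar>real (k choose i) * (-1) ^ (k - i) * (shifted_weight \<alpha> \<beta> (real k * h) x * f (y i x))\<bar> powr p)"
          by (rule powr_sum_le) (use p in auto)
        also have "\<dots> \<le> (\<Sum>i=0..k. real (k choose i) powr p * \<bar>jacobi_weight \<alpha> \<beta> (y i x) * g (y i x)\<bar> powr p)"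
        proof (rule sum_mono)
          fix i assume "i \<in> {0..k}"
          then have i: "i \<le> k" by simp
          have "\<bar>real (k choose i) * (-1) ^ (k - i) * (shifted_weight \<alpha> \<beta> (real k * h) x * f (y i x))\<bar> powr p
            = real (k choose i) powr p * \<bar>shifted_weight \<alpha> \<beta> (real k * h) x * g (y i x)\<bar> powr p"
            by (simp add: abs_mult power_abs powr_mult fg[OF i])
          also have "\<dots> \<le> real (k choose i) powr p * \<bar>jacobi_weight \<alpha> \<beta> (y i x) * g (y i x)\<bar> powr p"
            using W[OF i] p unfolding abs_mult by (intro mult_left_mono powr_mono2 mult_right_mono) auto
          finally show "\<bar>real (k choose i) * (-1) ^ (k - i) * (shifted_weight \<alpha> \<beta> (real k * h) x * f (y i x))\<bar> powr p
            \<le> real (k choose i) powr p * \<bar>jacobi_weight \<alpha> \<beta> (y i x) * g (y i x)\<bar> powr p" .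
        qed
        finally have "ennreal (\<bar>shifted_weight \<alpha> \<beta> (real k * h) x * sym_diff k (h * phi x) f x\<bar> powr p) \<le>
          ennreal (\<Sum>i=0..k. real (k choose i) powr p * \<bar>jacobi_weight \<alpha> \<beta> (y i x) * g (y i x)\<bar> powr p)"
          by (rule ennreal_leI)
        also have "\<dots> = (\<Sum>i=0..k. ennreal (real (k choose i) powr p) * (F (y i x) * indicator {-x0..x0} x))"
          unfolding F_def using x_in y_in
          by (subst sum_ennreal[symmetric]) (auto intro!: sum.cong simp: ennreal_mult)
        finally show ?thesis by (simp add: H_def)
      next
        case False
        then have "sym_diff k (h * phi x) f x = 0" by (simp only: sym_diff_def if_False)
        then show ?thesis by simp
      qed
    qed
  qed
  have intF: "(\<integral>\<^sup>+x. F x \<partial>lborel) = (\<integral>\<^sup>+x. ennreal (\<bar>jacobi_weight \<alpha> \<beta> x * f x\<bar> powr p) \<partial>lebesgue_on {-1..1})"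
    unfolding nn_integral_lebesgue_on_Icc
  proof (rule nn_integral_cong_AE)
    show "AE x in lborel. F x = ennreal (\<bar>jacobi_weight \<alpha> \<beta> x * f x\<bar> powr p) * indicator {-1..1} x"
      using ae_g by eventually_elim (auto simp: F_def fR_def indicator_def)
  qed
  have "(\<integral>\<^sup>+x. H x \<partial>lborel) = (\<Sum>i=0..k. ennreal (real (k choose i) powr p) * (\<integral>\<^sup>+x. F (y i x) * indicator {-x0..x0} x \<partial>lborel))"
    unfolding H_def by (subst nn_integral_sum) (auto simp: nn_integral_cmult)
  also have "\<dots> \<le> (\<Sum>i=0..k. ennreal (real (k choose i) powr p) * (2 * (\<integral>\<^sup>+x. F x \<partial>lborel)))"
    by (intro sum_mono mult_left_mono stretch) auto
  also have "\<dots> = ennreal (diff_const k p) * (\<integral>\<^sup>+x. F x \<partial>lborel)"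
  proof -
    have "ennreal (diff_const k p) = (\<Sum>i=0..k. ennreal (real (k choose i) powr p)) * 2"
      by (simp add: diff_const_def ennreal_mult sum_nonneg sum_ennreal mult.commute)
    then show ?thesis by (simp only: mult.assoc sum_distrib_right)
  qed
  finally show ?thesis using ae H intF by (intro bexI[of _ H]) auto
qed

section \<open>Best approximation and dyadic sums\<close>

lemma ennreal_powr_ennreal: "r \<ge> 0 \<Longrightarrow> ennreal_powr (ennreal r) p = ennreal (r powr p)"
  by (simp add: ennreal_powr_def)

text \<open>The two powers form a Galois connection on all of \<open>ennreal\<close>, including
  infinity. It moves p-th powers across the SUP in the modulus and the INF in the best approximation
  without continuity arguments.\<close>

lemma ennreal_powr_le_iff:
  assumes "p > 0"
  shows "ennreal_powr x p \<le> B \<longleftrightarrow> x \<le> ennreal_powr B (1 / p)"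
proof (cases x rule: ennreal_cases)
  case (real r)
  note x = this
  show ?thesis
  proof (cases B rule: ennreal_cases)
    case (real b)
    have "r powr p \<le> b \<longleftrightarrow> r \<le> b powr (1 / p)"
    proof
      assume "r powr p \<le> b"
      then have "(r powr p) powr (1 / p) \<le> b powr (1 / p)" using assms by (intro powr_mono2) auto
      then show "r \<le> b powr (1 / p)" using assms x by (simp add: powr_powr)
    next
      assume "r \<le> b powr (1 / p)"
      then have "r powr p \<le> (b powr (1 / p)) powr p" using assms x by (intro powr_mono2) auto
      then show "r powr p \<le> b" using assms real by (simp add: powr_powr)
    qed
    then show ?thesis using x real by (simp add: ennreal_powr_ennreal)
  qed (simp add: ennreal_powr_def)
next
  case top
  then show ?thesis
    by (cases B rule: ennreal_cases) (auto simp: ennreal_powr_def top_unique)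
qed

lemma ennreal_powr_inverse: "p > 0 \<Longrightarrow> ennreal_powr (ennreal_powr x (1 / p)) p = x"
  by (cases x rule: ennreal_cases) (simp_all add: ennreal_powr_ennreal powr_powr, simp add: ennreal_powr_def)

text \<open>The p-th power of \<open>Lp_norm\<close>: the quantity that is subadditive for p \<le>
  1, and in which all estimates are made.\<close>

definition Lp_energy :: "real \<Rightarrow> (real \<Rightarrow> real) \<Rightarrow> ennreal" where
  "Lp_energy p g = (\<integral>\<^sup>+x. ennreal (\<bar>g x\<bar> powr p) \<partial>lebesgue_on {-1..1})"

lemma Lp_norm_le_iff: "p > 0 \<Longrightarrow> Lp_norm p g \<le> ennreal_powr B (1 / p) \<longleftrightarrow> Lp_energy p g \<le> B"
  unfolding Lp_norm_def Lp_energy_def using ennreal_powr_le_iff[symmetric] by (metis ennreal_powr_inverse)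

lemma phi_modulus_powr_le:
  assumes "p > 0"
    and "\<And>h. 0 \<le> h \<Longrightarrow> h \<le> t \<Longrightarrow> Lp_energy p (\<lambda>x. shifted_weight \<alpha> \<beta> (real k * h) x * sym_diff k (h * phi x) f x) \<le> B"
  shows "ennreal_powr (phi_modulus k f t \<alpha> \<beta> p) p \<le> B"
  unfolding ennreal_powr_le_iff[OF assms(1)] phi_modulus_def
  by (intro SUP_least) (auto simp: Lp_norm_le_iff assms)

lemma best_approx_near_optimal:
  assumes p: "p > 0" and f: "f \<in> weighted_Lp \<alpha> \<beta> p" and m: "m \<ge> 1" and e: "\<epsilon> > 0"
  shows "\<exists>q. degree q < m \<and>
    Lp_energy p (\<lambda>x. jacobi_weight \<alpha> \<beta> x * (f x - poly q x)) \<le> ennreal_powr (best_approx m f \<alpha> \<beta> p) p + ennreal \<epsilon>"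
proof (rule ccontr)
  let ?E = "best_approx m f \<alpha> \<beta> p"
  assume "\<not> ?thesis"
  then have far: "ennreal_powr ?E p + ennreal \<epsilon> < Lp_energy p (\<lambda>x. jacobi_weight \<alpha> \<beta> x * (f x - poly q x))" if "degree q < m" for q
    using that by (meson not_le)
  \<comment> \<open>The zero polynomial is a competitor, so the infimum is finite for f in the
    space. Otherwise adding \<epsilon> would not increase it and there would be no
    contradiction.\<close>
  have "?E \<le> Lp_norm p (\<lambda>x. jacobi_weight \<alpha> \<beta> x * (f x - poly 0 x))"
    unfolding best_approx_def by (rule INF_lower) (use m in \<open>auto simp: polys_below_def\<close>)
  also have "\<dots> < \<infinity>" using f by (simp add: weighted_Lp_def)
  finally have fin: "?E < \<infinity>" .
  then obtain r where r: "?E = ennreal r" "r \<ge> 0" by (cases ?E rule: ennreal_cases) auto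
  have "ennreal_powr (ennreal_powr ?E p + ennreal \<epsilon>) (1 / p) \<le> ?E"
    unfolding best_approx_def
  proof (rule INF_greatest)
    fix q assume "q \<in> polys_below m"
    then have "degree q < m" by (simp add: polys_below_def)
    from far[OF this] have "ennreal_powr ?E p + ennreal \<epsilon> \<le> Lp_energy p (\<lambda>x. jacobi_weight \<alpha> \<beta> x * (f x - poly q x))"
      by (rule less_imp_le)
    also have "\<dots> = ennreal_powr (Lp_norm p (\<lambda>x. jacobi_weight \<alpha> \<beta> x * (f x - poly q x))) p"
      using p by (simp add: Lp_norm_def Lp_energy_def ennreal_powr_inverse)
    finally show "ennreal_powr (ennreal_powr (INF q\<in>polys_below m. Lp_norm p (\<lambda>x. jacobi_weight \<alpha> \<beta> x * (f x - poly q x))) p + ennreal \<epsilon>) (1 / p)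
        \<le> Lp_norm p (\<lambda>x. jacobi_weight \<alpha> \<beta> x * (f x - poly q x))"
      using p ennreal_powr_le_iff[of "1 / p"] unfolding best_approx_def by simp
  qed
  then have "ennreal_powr ?E p + ennreal \<epsilon> \<le> ennreal_powr ?E p"
    using p ennreal_powr_le_iff[of "1 / p"] by simp
  then show False using r e by (simp add: ennreal_powr_ennreal flip: ennreal_plus)
qed

lemma best_approx_powr_antimono:
  assumes "p > 0" "m \<le> n"
  shows "ennreal_powr (best_approx n f \<alpha> \<beta> p) p \<le> ennreal_powr (best_approx m f \<alpha> \<beta> p) p"
proof -
  have "best_approx n f \<alpha> \<beta> p \<le> best_approx m f \<alpha> \<beta> p"
    unfolding best_approx_def by (rule INF_superset_mono) (use assms in \<open>auto simp: polys_below_def\<close>)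
  also have "\<dots> \<le> ennreal_powr (ennreal_powr (best_approx m f \<alpha> \<beta> p) p) (1 / p)"
    using assms ennreal_powr_le_iff by blast
  finally show ?thesis using assms ennreal_powr_le_iff by blast
qed

text \<open>The block from 2 ^ L + 1 to 2 ^ Suc L has 2 ^ L indices. On it E m is at least its value
  at the right end, and m powr (s - 1) is at least 2 powr (- s) times its value there. Since 2 ^ L
  is half of 2 ^ Suc L, the constant is 2 * 2 powr s.\<close>

lemma dyadic_sum_le:
  fixes E :: "nat \<Rightarrow> ennreal"
  assumes s: "s > 0" and anti: "\<And>m n. m \<le> n \<Longrightarrow> E n \<le> E m"
  shows "(\<Sum>j\<le>L. ennreal ((2 ^ j) powr s) * E (2 ^ j)) \<le> ennreal (2 powr (s + 1)) * (\<Sum>m=1..2 ^ L. ennreal (real m powr (s - 1)) * E m)"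
proof (induction L)
  case 0
  have "1 * E 1 \<le> ennreal (2 powr (s + 1)) * E 1"
    using s by (intro mult_right_mono) (auto intro!: ge_one_powr_ge_zero)
  then show ?case by simp
next
  case (Suc L)
  let ?B = "{2 ^ L + 1..2 ^ Suc L} :: nat set"
  let ?t = "\<lambda>m. ennreal (real m powr (s - 1)) * E m"
  \<comment> \<open>The least value of m powr (s - 1) is near the left end of the block if s \<ge> 1
    and at the right end if s < 1. The factor 2 powr (- s) covers both cases.\<close>
  have weight: "(2 ^ Suc L) powr (s - 1) * 2 powr (- s) \<le> real m powr (s - 1)" if "m \<in> ?B" for m
  proof -
    have "2 ^ L \<le> m" "m \<le> 2 ^ Suc L" using that by auto
    then have "real (2 ^ L) \<le> real m" "real m \<le> real (2 ^ Suc L)" by (simp_all only: of_nat_le_iff)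
    then have m: "2 ^ L \<le> real m" "real m \<le> 2 ^ Suc L" by simp_all
    show ?thesis
    proof (cases "s \<ge> 1")
      case True
      have "(2 ^ Suc L) powr (s - 1) * 2 powr (- s) = (2 ^ L) powr (s - 1) * (2 powr (s - 1) * 2 powr (- s))"
        by (simp add: powr_mult)
      also have "2 powr (s - 1) * 2 powr (- s) = (1 / 2 :: real)"
        using powr_add[of 2 "s - 1" "- s"] by (simp add: powr_minus_divide)
      also have "(2 ^ L) powr (s - 1) * (1 / 2) \<le> (2 ^ L :: real) powr (s - 1)" by simp
      also have "\<dots> \<le> real m powr (s - 1)" using m True by (intro powr_mono2) auto
      finally show ?thesis .
    next
      case False
      have "(2 ^ Suc L) powr (s - 1) * 2 powr (- s) \<le> (2 ^ Suc L) powr (s - 1) * 1"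
        using s powr_mono[of "- s" 0 2] by (intro mult_left_mono) auto
      also have "(2 ^ Suc L) powr (s - 1) * 1 \<le> real m powr (s - 1)"
        unfolding mult_1_right
      proof (rule powr_mono2')
        show "0 < real m" using m(1) zero_less_power[of "2::real" L] by linarith
      qed (use False m(2) in auto)
      finally show ?thesis .
    qed
  qed
  have "ennreal ((2 ^ Suc L) powr s) * E (2 ^ Suc L) = (\<Sum>m\<in>?B. ennreal (2 powr (s + 1)) * (ennreal ((2 ^ Suc L) powr (s - 1) * 2 powr (- s)) * E (2 ^ Suc L)))"
  proof -
    have "(2 ^ Suc L) powr s = 2 ^ L * (2 powr (s + 1) * ((2 ^ Suc L) powr (s - 1) * 2 powr (- s)))"
    proof -
      let ?x = "(2 ^ Suc L) powr (s - 1) :: real"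
      have "2 powr (s + 1) * 2 powr (- s) = (2::real)" by (simp flip: powr_add)
      then have "2 ^ L * (2 powr (s + 1) * (?x * 2 powr (- s))) = 2 ^ L * (2 * ?x)"
        by (metis mult.assoc mult.commute)
      also have "\<dots> = (2 ^ Suc L) powr s" by (simp only: powr_diff) simp
      finally show ?thesis by (rule sym)
    qed
    then have "ennreal ((2 ^ Suc L) powr s) = of_nat (2 ^ L) * (ennreal (2 powr (s + 1)) * ennreal ((2 ^ Suc L) powr (s - 1) * 2 powr (- s)))"
      by (simp add: ennreal_mult flip: ennreal_of_nat_eq_real_of_nat ennreal_power)
    then show ?thesis by (simp add: mult.assoc)
  qed
  also have "\<dots> \<le> (\<Sum>m\<in>?B. ennreal (2 powr (s + 1)) * ?t m)"
    by (intro sum_mono mult_left_mono mult_mono ennreal_leI weight anti) auto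
  finally have step: "ennreal ((2 ^ Suc L) powr s) * E (2 ^ Suc L) \<le> ennreal (2 powr (s + 1)) * (\<Sum>m\<in>?B. ?t m)"
    by (simp add: sum_distrib_left)
  have "{1..2 ^ Suc L} = {1..2 ^ L} \<union> ?B" by auto
  then have split: "(\<Sum>m=1..2 ^ Suc L. ?t m) = (\<Sum>m=1..2 ^ L. ?t m) + (\<Sum>m\<in>?B. ?t m)"
    by (simp only:) (rule sum.union_disjoint, auto)
  show ?case
    unfolding split distrib_left using add_mono[OF Suc step] by (simp only: sum.atMost_Suc)
qed

section \<open>Telescoping\<close>

lemma sym_diff_split: "sym_diff k h f x = sym_diff k h (\<lambda>x. f x - g x) x + sym_diff k h g x"
  by (simp add: sym_diff_def right_diff_distrib sum_subtractf)

lemma alternating_choose_sum: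
  assumes "k \<ge> 1"
  shows "(\<Sum>i=0..k. real (k choose i) * (-1) ^ (k - i)) = 0"
proof -
  have "(\<Sum>i=0..k. real (k choose i) * (-1) ^ (k - i)) = (1 + (-1)) ^ k"
    by (subst binomial_ring) (simp add: atMost_atLeast0)
  then show ?thesis using assms by simp
qed

lemma sym_diff_const: "k \<ge> 1 \<Longrightarrow> sym_diff k h (\<lambda>x. c) x = 0"
  using alternating_choose_sum[of k] by (simp add: sym_diff_def flip: sum_distrib_right)

lemma sym_diff_zero_step: "k \<ge> 1 \<Longrightarrow> sym_diff k 0 f x = 0"
  using alternating_choose_sum[of k] by (simp add: sym_diff_def flip: sum_distrib_right)

text \<open>The difference annihilates the constant P 0 because k \<ge> 1, so the telescoping sum
  leaves no initial term.\<close>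

lemma sym_diff_telescope:
  assumes "k \<ge> 1" "degree (P 0) = 0"
  shows "sym_diff k h f x = sym_diff k h (\<lambda>x. f x - poly (P L) x) x + (\<Sum>j<L. sym_diff k h (poly (P (Suc j) - P j)) x)"
proof -
  have "sym_diff k h (poly (P L)) x = (\<Sum>j<L. sym_diff k h (poly (P (Suc j) - P j)) x)"
  proof (induction L)
    case 0
    obtain c where "P 0 = [:c:]" using assms(2) degree_eq_zeroE by blast
    then have "poly (P 0) = (\<lambda>x. c)" by auto
    then show ?case using assms by (simp add: sym_diff_const)
  next
    case (Suc L)
    then show ?case
      using sym_diff_split[of k h "poly (P (Suc L))" x "poly (P L)"] by (simp add: poly_diff[abs_def])
  qed
  then show ?thesis using sym_diff_split[of k h f x "poly (P L)"] by simp
qed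

text \<open>The centre x belongs to its own segment, so the shifted weight is at most the Jacobi
  weight at x. Where the cut-off acts, the left side is 0. This links the modulus to
  \<open>bernstein_difference\<close>.\<close>

lemma shifted_sym_diff_le_full_diff:
  assumes "x \<in> {-1..1}" "h \<ge> 0" "\<alpha> \<ge> 0" "\<beta> \<ge> 0"
  shows "\<bar>shifted_weight \<alpha> \<beta> (real k * h) x * sym_diff k (h * phi x) f x\<bar> \<le> \<bar>jacobi_weight \<alpha> \<beta> x * full_diff k (h * phi x) f x\<bar>"
proof (cases "{x - real k * (h * phi x) / 2 .. x + real k * (h * phi x) / 2} \<subseteq> {-1..1}")
  case True
  then have "real k * h * phi x / 2 \<le> 1 - x" "real k * h * phi x / 2 \<le> 1 + x"
    using segment_in_Icc_iff assms by blast+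
  then have "0 \<le> shifted_weight \<alpha> \<beta> (real k * h) x" "shifted_weight \<alpha> \<beta> (real k * h) x \<le> jacobi_weight \<alpha> \<beta> x"
    using shifted_weight_le[of x x "real k * h" \<alpha> \<beta>] assms phi_nonneg[OF assms(1)] by auto
  then show ?thesis using True by (simp add: sym_diff_alt abs_mult mult_right_mono)
next
  case False
  then have "sym_diff k (h * phi x) f x = 0" by (simp only: sym_diff_alt if_False)
  then show ?thesis by simp
qed

lemma Lp_energy_add_le:
  assumes p: "0 < p" "p \<le> 1" 
    and [measurable]: "g \<in> borel_measurable (lebesgue_on {-1..1})" "h \<in> borel_measurable (lebesgue_on {-1..1})"
  shows "Lp_energy p (\<lambda>x. g x + h x) \<le> Lp_energy p g + Lp_energy p h"
proof -
  have "Lp_energy p (\<lambda>x. g x + h x) \<le> (\<integral>\<^sup>+x. ennreal (\<bar>g x\<bar> powr p) + ennreal (\<bar>h x\<bar> powr p) \<partial>lebesgue_on {-1..1})"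
    unfolding Lp_energy_def
  proof (rule nn_integral_mono)
    fix x
    have "\<bar>g x + h x\<bar> powr p \<le> (\<bar>g x\<bar> + \<bar>h x\<bar>) powr p" using p by (intro powr_mono2) auto
    also have "\<dots> \<le> \<bar>g x\<bar> powr p + \<bar>h x\<bar> powr p" using p by (intro powr_add_le) auto
    finally show "ennreal (\<bar>g x + h x\<bar> powr p) \<le> ennreal (\<bar>g x\<bar> powr p) + ennreal (\<bar>h x\<bar> powr p)"
      by (simp flip: ennreal_plus add: ennreal_leI)
  qed
  also have "\<dots> = Lp_energy p g + Lp_energy p h"
    unfolding Lp_energy_def by (rule nn_integral_add) measurable
  finally show ?thesis .
qed

lemma borel_measurable_lebesgue_on: "f \<in> borel_measurable borel \<Longrightarrow> f \<in> borel_measurable (lebesgue_on S)"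
  by (intro measurable_restrict_space1 measurable_completion) simp

lemma Lp_energy_poly_diff_le:
  assumes p: "0 < p" "p \<le> 1" and f: "f \<in> borel_measurable (lebesgue_on {-1..1})"
  shows "Lp_energy p (\<lambda>x. jacobi_weight \<alpha> \<beta> x * poly (Q - R) x) \<le>
    Lp_energy p (\<lambda>x. jacobi_weight \<alpha> \<beta> x * (f x - poly Q x)) + Lp_energy p (\<lambda>x. jacobi_weight \<alpha> \<beta> x * (f x - poly R x))"
proof -
  have [measurable]: "f \<in> borel_measurable (lebesgue_on {-1..1})"
    "jacobi_weight \<alpha> \<beta> \<in> borel_measurable (lebesgue_on {-1..1})"
    "poly Q \<in> borel_measurable (lebesgue_on {-1..1})" "poly R \<in> borel_measurable (lebesgue_on {-1..1})"
    by (rule f) (intro borel_measurable_lebesgue_on, measurable)+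
  have eq: "(\<lambda>x. jacobi_weight \<alpha> \<beta> x * poly (Q - R) x) =
    (\<lambda>x. - (jacobi_weight \<alpha> \<beta> x * (f x - poly Q x)) + jacobi_weight \<alpha> \<beta> x * (f x - poly R x))"
    by (auto simp: algebra_simps)
  have "Lp_energy p (\<lambda>x. jacobi_weight \<alpha> \<beta> x * poly (Q - R) x) \<le> Lp_energy p (\<lambda>x. - (jacobi_weight \<alpha> \<beta> x * (f x - poly Q x)))
      + Lp_energy p (\<lambda>x. jacobi_weight \<alpha> \<beta> x * (f x - poly R x))"
    unfolding eq by (rule Lp_energy_add_le[OF p]) measurable
  then show ?thesis by (simp add: Lp_energy_def)
qed

text \<open>The remainder f - P L has no smoothness, so only boundedness of the difference operator
  applies to it. The polynomial blocks pass to \<open>full_diff\<close>, ready for the Bernstein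
  estimate. Subadditivity is used pointwise, under the integral, where only the Borel majorants have
  to be added.\<close>

lemma Lp_energy_difference_decomposition:
  assumes k: "k \<ge> 1" and p: "0 < p" "p \<le> 1" and \<alpha>\<beta>: "\<alpha> \<ge> 0" "\<beta> \<ge> 0"
    and h: "0 < h" "real k * h \<le> 1" and f: "f \<in> borel_measurable (lebesgue_on {-1..1})" and P0: "degree (P 0) = 0"
  shows "Lp_energy p (\<lambda>x. shifted_weight \<alpha> \<beta> (real k * h) x * sym_diff k (h * phi x) f x) \<le>
    ennreal (diff_const k p) * Lp_energy p (\<lambda>x. jacobi_weight \<alpha> \<beta> x * (f x - poly (P L) x)) +
    (\<Sum>j<L. Lp_energy p (\<lambda>x. jacobi_weight \<alpha> \<beta> x * full_diff k (h * phi x) (poly (P (Suc j) - P j)) x))"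
proof -
  define r where "r x = f x - poly (P L) x" for x
  define D where "D j x = ennreal (\<bar>jacobi_weight \<alpha> \<beta> x * full_diff k (h * phi x) (poly (P (Suc j) - P j)) x\<bar> powr p)" for j x
  have [measurable]: "D j \<in> borel_measurable borel" for j
    unfolding D_def full_diff_def by measurable
  have "r \<in> borel_measurable (lebesgue_on {-1..1})"
    unfolding r_def by (intro borel_measurable_diff[OF f] borel_measurable_lebesgue_on) measurable
  from weighted_difference_bounded[OF k p \<alpha>\<beta> h this]
  obtain H where H [measurable]: "H \<in> borel_measurable borel" and
    aeH: "AE x in lborel. x \<in> {-1..1} \<longrightarrow>
      ennreal (\<bar>shifted_weight \<alpha> \<beta> (real k * h) x * sym_diff k (h * phi x) r x\<bar> powr p) \<le> H x" and
    intH: "(\<integral>\<^sup>+x. H x \<partial>lborel) \<le> ennreal (diff_const k p) * Lp_energy p (\<lambda>x. jacobi_weight \<alpha> \<beta> x * r x)"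
    unfolding Lp_energy_def by blast
  have "Lp_energy p (\<lambda>x. shifted_weight \<alpha> \<beta> (real k * h) x * sym_diff k (h * phi x) f x) \<le>
    (\<integral>\<^sup>+x. H x + (\<Sum>j<L. D j x * indicator {-1..1} x) \<partial>lborel)"
    unfolding Lp_energy_def nn_integral_lebesgue_on_Icc
  proof (rule nn_integral_mono_AE)
    show "AE x in lborel. ennreal (\<bar>shifted_weight \<alpha> \<beta> (real k * h) x * sym_diff k (h * phi x) f x\<bar> powr p) * indicator {-1..1} x
      \<le> H x + (\<Sum>j<L. D j x * indicator {-1..1} x)"
      using aeH
    proof eventually_elim
      case (elim x)
      show ?case
      proof (cases "x \<in> {-1..1}")
        case True
        define W where "W = shifted_weight \<alpha> \<beta> (real k * h) x"
        define t where "t j = sym_diff k (h * phi x) (poly (P (Suc j) - P j)) x" for j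
        have "\<bar>W * sym_diff k (h * phi x) f x\<bar> powr p = \<bar>W * sym_diff k (h * phi x) r x + (\<Sum>j<L. W * t j)\<bar> powr p"
          using sym_diff_telescope[where P = P, OF k P0, of "h * phi x" f x L]
          by (simp add: r_def[abs_def] t_def distrib_left sum_distrib_left)
        also have "\<dots> \<le> (\<bar>W * sym_diff k (h * phi x) r x\<bar> + \<bar>\<Sum>j<L. W * t j\<bar>) powr p"
          using p by (intro powr_mono2) auto
        also have "\<dots> \<le> \<bar>W * sym_diff k (h * phi x) r x\<bar> powr p + \<bar>\<Sum>j<L. W * t j\<bar> powr p"
          using p by (intro powr_add_le) auto
        also have "\<dots> \<le> \<bar>W * sym_diff k (h * phi x) r x\<bar> powr p + (\<Sum>j<L. \<bar>W * t j\<bar> powr p)"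
          using p by (intro add_left_mono powr_sum_le) auto
        finally have "ennreal (\<bar>W * sym_diff k (h * phi x) f x\<bar> powr p) \<le>
          ennreal (\<bar>W * sym_diff k (h * phi x) r x\<bar> powr p) + (\<Sum>j<L. ennreal (\<bar>W * t j\<bar> powr p))"
          by (subst sum_ennreal) (auto simp: sum_nonneg simp flip: ennreal_plus intro: ennreal_leI)
        also have "\<dots> \<le> H x + (\<Sum>j<L. D j x)"
          unfolding D_def W_def t_def using elim True shifted_sym_diff_le_full_diff[OF True _ \<alpha>\<beta>, of h k] h p
          by (intro add_mono sum_mono ennreal_leI powr_mono2) auto
        finally show ?thesis using True by (simp add: W_def)
      qed simp
    qed
  qed
  also have "\<dots> = (\<integral>\<^sup>+x. H x \<partial>lborel) + (\<Sum>j<L. \<integral>\<^sup>+x. D j x * indicator {-1..1} x \<partial>lborel)"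
  proof -
    have "(\<integral>\<^sup>+x. (\<Sum>j<L. D j x * indicator {-1..1} x) \<partial>lborel) = (\<Sum>j<L. \<integral>\<^sup>+x. D j x * indicator {-1..1} x \<partial>lborel)"
      by (rule nn_integral_sum) measurable
    then show ?thesis by (subst nn_integral_add) measurable
  qed
  also have "\<dots> \<le> ennreal (diff_const k p) * Lp_energy p (\<lambda>x. jacobi_weight \<alpha> \<beta> x * r x) +
    (\<Sum>j<L. Lp_energy p (\<lambda>x. jacobi_weight \<alpha> \<beta> x * full_diff k (h * phi x) (poly (P (Suc j) - P j)) x))"
    using intH by (intro add_mono) (auto simp: D_def Lp_energy_def nn_integral_lebesgue_on_Icc)
  finally show ?thesis unfolding r_def .
qed

lemma diff_const_nonneg: "diff_const k p \<ge> 0"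
  by (simp add: diff_const_def sum_nonneg)

theorem theorem1p11:
  fixes k :: nat and p \<alpha> \<beta> :: real
  assumes "k \<ge> 1" and "0 < p" and "p < 1" and "\<alpha> \<ge> 0" and "\<beta> \<ge> 0"
  shows "\<exists>\<theta>>0. \<theta> \<le> 1 \<and>
    (\<exists>c>0. \<forall>f\<in>weighted_Lp \<alpha> \<beta> p. \<forall>n\<ge>1.
       ennreal_powr (phi_modulus k f (\<theta> / real n) \<alpha> \<beta> p) p
       \<le> ennreal (c * real n powr (- (real k * p))) *
          (\<Sum>m=1..n. ennreal (real m powr (real k * p - 1)) *
             ennreal_powr (best_approx m f \<alpha> \<beta> p) p))"
proof -
  define s where "s = real k * p"
  have s: "s > 0" using assms by (simp add: s_def)
  have p: "0 < p" "p \<le> 1" using assms by auto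
  obtain C1 where C1: "C1 > 0" and bernstein: "\<And>P n h. degree P < n \<Longrightarrow> 0 \<le> h \<Longrightarrow> real k * h \<le> 1 / (8 * real n) \<Longrightarrow>
    Lp_energy p (\<lambda>x. jacobi_weight \<alpha> \<beta> x * full_diff k (h * phi x) (poly P) x)
    \<le> ennreal (C1 * (real n * h) powr s) * Lp_energy p (\<lambda>x. jacobi_weight \<alpha> \<beta> x * poly P x)"
  proof -
    from bernstein_difference[OF assms(1,2,4,5), folded Lp_energy_def s_def] obtain C where "C > 0"
      and C: "\<forall>P n h. degree P < n \<longrightarrow> 0 \<le> h \<longrightarrow> real k * h \<le> 1 / (8 * real n) \<longrightarrow>
      Lp_energy p (\<lambda>x. jacobi_weight \<alpha> \<beta> x * full_diff k (h * phi x) (poly P) x)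
      \<le> ennreal (C * (real n * h) powr s) * Lp_energy p (\<lambda>x. jacobi_weight \<alpha> \<beta> x * poly P x)"
      by (elim exE conjE) (rule that)
    then show ?thesis by (intro that[of C]) blast+
  qed
  \<comment> \<open>One constant for both kinds of terms: \<open>diff_const\<close> for the
    remainder, C1 for the blocks with 2 from splitting the energy of P (Suc j) - P j. The factor 2
    powr s absorbs one dyadic step in either case.\<close>
  define K where "K = 2 powr s * (diff_const k p + 2 * C1)"
  have K: "K > 0" using C1 diff_const_nonneg[of k p] by (simp add: K_def add_nonneg_pos)
  \<comment> \<open>With h \<le> \<theta> / n this gives k * h \<le> 1 / (8 n), the hypothesis of
    \<open>bernstein\<close> for every degree bound up to n.\<close>
  define \<theta> where "\<theta> = 1 / (8 * real k)"
  have theta: "\<theta> > 0" "\<theta> \<le> 1" using assms(1) by (auto simp: \<theta>_def field_simps)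
  define c where "c = K * 2 powr (s + 1)"
  have c: "c > 0" using K by (simp add: c_def)
  have main: "Lp_energy p (\<lambda>x. shifted_weight \<alpha> \<beta> (real k * h) x * sym_diff k (h * phi x) f x)
     \<le> ennreal (c * real n powr (- s)) * (\<Sum>m=1..n. ennreal (real m powr (s - 1)) * ennreal_powr (best_approx m f \<alpha> \<beta> p) p)"
    if f: "f \<in> weighted_Lp \<alpha> \<beta> p" and n: "n \<ge> 1" and h: "0 < h" "h \<le> \<theta> / real n" for f n h
  proof -
    define E where "E m = ennreal_powr (best_approx m f \<alpha> \<beta> p) p" for m
    define V where "V P = Lp_energy p (\<lambda>x. jacobi_weight \<alpha> \<beta> x * (f x - poly P x))" for P
    have f_meas: "f \<in> borel_measurable (lebesgue_on {-1..1})" using f by (simp add: weighted_Lp_def)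
    have anti: "E n \<le> E m" if "m \<le> n" for m n
      unfolding E_def using p that by (intro best_approx_powr_antimono)
    have near: "\<exists>q. degree q < m \<and> V q \<le> E m + ennreal \<epsilon>" if "m \<ge> 1" "\<epsilon> > 0" for m \<epsilon>
      unfolding E_def V_def using best_approx_near_optimal[OF p(1) f that] .
    obtain L where L: "2 ^ L \<le> n" "n < 2 ^ Suc L"
      using ex_power_ivl1[of 2 n] n by auto
    then have L': "2 ^ L \<le> real n" "real n \<le> 2 ^ Suc L"
    proof -
      have "real (2 ^ L) \<le> real n" "real n \<le> real (2 ^ Suc L)" using L by (simp_all only: of_nat_le_iff less_imp_le)
      then show "2 ^ L \<le> real n" "real n \<le> 2 ^ Suc L" by simp_all
    qed
    have kh: "real k * h \<le> 1 / (8 * real n)"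
    proof -
      have "real k * h \<le> real k * (\<theta> / real n)" using h by (intro mult_left_mono) auto
      then show ?thesis using assms(1) by (simp add: \<theta>_def)
    qed
    have nh: "real n * h \<le> 1"
      using h theta n by (simp add: field_simps)
    define T where "T = (\<Sum>j\<le>L. (2 ^ j :: real) powr s)"
    have T: "T > 0" unfolding T_def by (intro sum_pos) auto
    let ?S = "\<Sum>j\<le>L. ennreal ((2 ^ j) powr s) * E (2 ^ j)"
    \<comment> \<open>The near-best approximants contribute an error K * n powr (- s) * T *
      \<epsilon> in total. It is made equal to an arbitrary e > 0 and then removed by letting e tend
      to 0.\<close>
    have eps: "Lp_energy p (\<lambda>x. shifted_weight \<alpha> \<beta> (real k * h) x * sym_diff k (h * phi x) f x)
      \<le> ennreal (K * real n powr (- s)) * ?S + ennreal e" if e: "e > 0" for e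
    proof -
      define \<epsilon> where "\<epsilon> = e / (K * real n powr (- s) * T)"
      have \<epsilon>: "\<epsilon> > 0" using e K T n by (simp add: \<epsilon>_def)
      have "\<exists>q. degree q < 2 ^ j \<and> V q \<le> E (2 ^ j) + ennreal \<epsilon>" for j :: nat
        using near[of "2 ^ j" \<epsilon>] \<epsilon> by simp
      then obtain P where P: "\<And>j. degree (P j) < 2 ^ j" "\<And>j. V (P j) \<le> E (2 ^ j) + ennreal \<epsilon>" by metis
      have P0: "degree (P 0) = 0" using P(1)[of 0] by simp
      define A where "A j = E (2 ^ j) + ennreal \<epsilon>" for j
      define w where "w j = real n powr (- s) * (2 ^ j) powr s" for j :: nat
      have w0: "w j \<ge> 0" for j by (simp add: w_def)
      \<comment> \<open>For j < L the degree bound 2 ^ Suc j is at most n, so the step condition for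
        n suffices. Then n * h \<le> 1 gives (2 ^ Suc j * h) powr s \<le> 2 powr s * w j, and both
        approximants in the block have energy at most A j by monotonicity of E.\<close>
      have block: "Lp_energy p (\<lambda>x. jacobi_weight \<alpha> \<beta> x * full_diff k (h * phi x) (poly (P (Suc j) - P j)) x)
        \<le> ennreal (2 powr s * (2 * C1) * w j) * A j" if j: "j < L" for j
      proof -
        have jn: "real (2 ^ Suc j) \<le> real n"
        proof -
          have "(2::nat) ^ Suc j \<le> 2 ^ L" using j by (intro power_increasing) auto
          then show ?thesis using L(1) by (simp only: of_nat_le_iff)
        qed
        have "degree (P (Suc j) - P j) < 2 ^ Suc j"
          using P(1)[of j] P(1)[of "Suc j"] degree_diff_le_max[of "P (Suc j)" "P j"] by auto
        moreover have "real k * h \<le> 1 / (8 * real (2 ^ Suc j))"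
        proof -
          have "1 / (8 * real n) \<le> 1 / (8 * real (2 ^ Suc j))" using jn n by (intro divide_left_mono) auto
          then show ?thesis using kh by linarith
        qed
        ultimately have "Lp_energy p (\<lambda>x. jacobi_weight \<alpha> \<beta> x * full_diff k (h * phi x) (poly (P (Suc j) - P j)) x)
          \<le> ennreal (C1 * (real (2 ^ Suc j) * h) powr s) * Lp_energy p (\<lambda>x. jacobi_weight \<alpha> \<beta> x * poly (P (Suc j) - P j) x)"
          using h by (intro bernstein) auto
        also have "\<dots> \<le> ennreal (C1 * (2 powr s * w j)) * (2 * A j)"
        proof (intro mult_mono ennreal_leI mult_left_mono)
          have "h \<le> 1 / real n" using nh n by (simp add: field_simps)
          then have "(real (2 ^ Suc j) * h) powr s \<le> (real (2 ^ Suc j) * (1 / real n)) powr s"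
            using h s by (intro powr_mono2 mult_left_mono) auto
          also have "\<dots> = 2 powr s * w j"
            by (simp add: w_def powr_mult powr_divide powr_minus field_simps)
          finally show "(real (2 ^ Suc j) * h) powr s \<le> 2 powr s * w j" .
          have "Lp_energy p (\<lambda>x. jacobi_weight \<alpha> \<beta> x * poly (P (Suc j) - P j) x) \<le> V (P (Suc j)) + V (P j)"
            unfolding V_def by (rule Lp_energy_poly_diff_le[OF p f_meas])
          also have "\<dots> \<le> A j + A j"
            unfolding A_def using P(2)[of "Suc j"] P(2)[of j] anti[of "2 ^ j" "2 ^ Suc j"]
            by (intro add_mono) (auto intro: order.trans add_right_mono)
          finally show "Lp_energy p (\<lambda>x. jacobi_weight \<alpha> \<beta> x * poly (P (Suc j) - P j) x) \<le> 2 * A j" by (simp add: mult_2)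
        qed (use C1 in auto)
        also have "\<dots> = ennreal (2 powr s * (2 * C1) * w j) * A j"
        proof -
          have "2 powr s * (2 * C1) * w j = (C1 * (2 powr s * w j)) * 2" by simp
          then have "ennreal (2 powr s * (2 * C1) * w j) = ennreal (C1 * (2 powr s * w j)) * 2"
            using C1 w0[of j] by (simp only: ennreal_mult) (simp add: ennreal_mult)
          then show ?thesis by (simp add: mult.assoc)
        qed
        finally show ?thesis .
      qed
      \<comment> \<open>Boundedness alone yields no power of h, but none is needed: n \<le> 2 ^ Suc
        L gives 1 \<le> 2 powr s * w L.\<close>
      have last: "ennreal (diff_const k p) * V (P L) \<le> ennreal (2 powr s * diff_const k p * w L) * A L"
      proof (rule mult_mono)
        have "1 \<le> (2 ^ Suc L / real n) powr s" using L' n s by (intro ge_one_powr_ge_zero) auto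
        also have "\<dots> = 2 powr s * w L" by (simp add: w_def powr_mult powr_divide powr_minus field_simps)
        finally have "diff_const k p * 1 \<le> diff_const k p * (2 powr s * w L)"
          using diff_const_nonneg by (rule mult_left_mono)
        then show "ennreal (diff_const k p) \<le> ennreal (2 powr s * diff_const k p * w L)"
          by (intro ennreal_leI) (simp add: mult_ac)
      qed (use P(2)[of L] in \<open>auto simp: A_def\<close>)
      have "real k * h \<le> 1" 
      proof -
        have "1 / (8 * real n) \<le> 1" using n by simp
        with kh show ?thesis by linarith
      qed
      then have "Lp_energy p (\<lambda>x. shifted_weight \<alpha> \<beta> (real k * h) x * sym_diff k (h * phi x) f x)
        \<le> ennreal (diff_const k p) * V (P L) +
        (\<Sum>j<L. Lp_energy p (\<lambda>x. jacobi_weight \<alpha> \<beta> x * full_diff k (h * phi x) (poly (P (Suc j) - P j)) x))"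
        unfolding V_def using assms h f_meas P0 p by (intro Lp_energy_difference_decomposition) auto
      also have "\<dots> \<le> ennreal (K * w L) * A L + (\<Sum>j<L. ennreal (K * w j) * A j)"
      proof (intro add_mono sum_mono)
        have "2 powr s * diff_const k p * w L \<le> K * w L"
          using w0[of L] C1 unfolding K_def by (intro mult_right_mono mult_left_mono) auto
        then show "ennreal (diff_const k p) * V (P L) \<le> ennreal (K * w L) * A L"
          by (intro order.trans[OF last mult_right_mono[OF ennreal_leI]]) auto
        fix j assume "j \<in> {..<L}"
        then have j: "j < L" by simp
        have "2 powr s * (2 * C1) * w j \<le> K * w j"
          using w0[of j] diff_const_nonneg[of k p] unfolding K_def by (intro mult_right_mono mult_left_mono) auto
        then show "Lp_energy p (\<lambda>x. jacobi_weight \<alpha> \<beta> x * full_diff k (h * phi x) (poly (P (Suc j) - P j)) x) \<le> ennreal (K * w j) * A j"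
          by (intro order.trans[OF block[OF j] mult_right_mono[OF ennreal_leI]]) auto
      qed
      also have "\<dots> = (\<Sum>j\<le>L. ennreal (K * w j) * A j)"
        by (simp add: lessThan_Suc_atMost[symmetric] add.commute)
      also have "\<dots> = (\<Sum>j\<le>L. ennreal (K * real n powr (- s)) * (ennreal ((2 ^ j) powr s) * E (2 ^ j)) + ennreal (K * w j * \<epsilon>))"
      proof (intro sum.cong refl)
        fix j
        have "ennreal (K * w j) = ennreal (K * real n powr (- s)) * ennreal ((2 ^ j) powr s)"
          using K by (subst ennreal_mult[symmetric]) (auto simp: w_def mult.assoc)
        moreover have "ennreal (K * w j * \<epsilon>) = ennreal (K * w j) * ennreal \<epsilon>"
          using K w0[of j] \<epsilon> by (intro ennreal_mult) auto
        ultimately show "ennreal (K * w j) * A j = ennreal (K * real n powr (- s)) * (ennreal ((2 ^ j) powr s) * E (2 ^ j)) + ennreal (K * w j * \<epsilon>)"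
          by (simp add: A_def distrib_left mult.assoc)
      qed
      also have "\<dots> = ennreal (K * real n powr (- s)) * ?S + ennreal (\<Sum>j\<le>L. K * w j * \<epsilon>)"
        using K w0 \<epsilon> by (simp add: sum.distrib sum_distrib_left sum_ennreal)
      also have "(\<Sum>j\<le>L. K * w j * \<epsilon>) = K * real n powr (- s) * T * \<epsilon>"
        by (simp add: T_def w_def sum_distrib_left sum_distrib_right mult_ac)
      also have "\<dots> = e" using K T n by (simp add: \<epsilon>_def)
      finally show ?thesis .
    qed
    have "Lp_energy p (\<lambda>x. shifted_weight \<alpha> \<beta> (real k * h) x * sym_diff k (h * phi x) f x)
      \<le> ennreal (K * real n powr (- s)) * ?S"
      by (rule ennreal_le_epsilon) (rule eps)
    also have "\<dots> \<le> ennreal (K * real n powr (- s)) * (ennreal (2 powr (s + 1)) * (\<Sum>m=1..2 ^ L. ennreal (real m powr (s - 1)) * E m))"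
      by (intro mult_left_mono dyadic_sum_le s anti) auto
    also have "\<dots> \<le> ennreal (K * real n powr (- s)) * (ennreal (2 powr (s + 1)) * (\<Sum>m=1..n. ennreal (real m powr (s - 1)) * E m))"
      using L(1) by (intro mult_left_mono sum_mono2) auto
    also have "\<dots> = ennreal (c * real n powr (- s)) * (\<Sum>m=1..n. ennreal (real m powr (s - 1)) * E m)"
    proof -
      have "ennreal (c * real n powr (- s)) = ennreal (K * real n powr (- s)) * ennreal (2 powr (s + 1))"
        using K by (subst ennreal_mult[symmetric]) (auto simp: c_def mult_ac)
      then show ?thesis by (simp add: mult.assoc)
    qed
    finally show ?thesis unfolding E_def .
  qed
  show ?thesis
  proof (intro exI conjI ballI allI impI)
    fix f n assume f: "f \<in> weighted_Lp \<alpha> \<beta> p" and n: "(1::nat) \<le> n"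
    show "ennreal_powr (phi_modulus k f (\<theta> / real n) \<alpha> \<beta> p) p
       \<le> ennreal (c * real n powr (- (real k * p))) *
          (\<Sum>m=1..n. ennreal (real m powr (real k * p - 1)) * ennreal_powr (best_approx m f \<alpha> \<beta> p) p)"
    proof (rule phi_modulus_powr_le[OF p(1)])
      fix h :: real assume h: "0 \<le> h" "h \<le> \<theta> / real n"
      show "Lp_energy p (\<lambda>x. shifted_weight \<alpha> \<beta> (real k * h) x * sym_diff k (h * phi x) f x)
        \<le> ennreal (c * real n powr (- (real k * p))) *
          (\<Sum>m=1..n. ennreal (real m powr (real k * p - 1)) * ennreal_powr (best_approx m f \<alpha> \<beta> p) p)"
      \<comment> \<open>The substitution behind \<open>main\<close> needs h > 0. For h = 0 the
        difference vanishes identically because k \<ge> 1.\<close>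
      proof (cases "h = 0")
        case True
        then show ?thesis using assms(1) by (simp add: Lp_energy_def sym_diff_zero_step)
      next
        case False
        then show ?thesis using main[OF f n, of h] h by (simp add: s_def)
      qed
    qed
  qed (use theta c in auto)
qed

thm_deps theorem1p11

end
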